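(* Let $\mathcal{A}$ be a deterministic weave. Let $\mathcal{X}$ denote the set of Dedekind cuts of $\mathcal{A}_{\max}$. 1. The map $h\mapsto X_h$ is a bijection between $\mathrm{flow}(\mathcal{A})$ and $\mathcal{X}$. The inverse map is $X\mapsto P_X$. 2. For any $f\in\Pi^\uparrow$ that does not cross $\mathcal{A}$, there exists $h\in\mathrm{flow}(\mathcal{A})$ such that $f\subseteq h$.
   Context: Paths. Let $\overline{\mathbb R}=[-\infty,\infty]$. For $I\subseteq\overline{\mathbb R}$ let $I_{\mathfrak s}=\{t\star : t\in I,\ \star\in\{-,+\}\}$, where $t\star$ denotes the pair $(t,\star)$, ordered lexicographically with $t-<t+$; $\mathbb R_{\mathfrak s}$ carries the order topology. A (c\`adl\`ag) path $f$ has a closed interval domain $I(f)=[\sigma_f,\tau_f]\subseteq\overline{\mathbb R}$ (possibly a single point) and values $f(t\star)\in\overline{\mathbb R}$ for $t\in I(f)\cap\mathbb R$, such that $f(t+)=\lim_{s\downarrow t}f(s\pm)$ for real $t\in[\sigma_f,\tau_f)$ and $f(t-)=\lim_{s\uparrow t}f(s\pm)$ for real $t\in(\sigma_f,\tau_f]$. The values $f(\sigma_f-)$ and $f(\tau_f+)$ are otherwise unrestricted (jumps at initial and final times are allowed); nothing is required at times $\pm\infty$, where by convention $f$ takes the value $*$. Let $\Pi$ be the set of paths, $\Pi^\uparrow=\{f\in\Pi:\tau_f=\infty\}$, $\Pi^\downarrow=\{f\in\Pi:\sigma_f=-\infty\}$, $\Pi^{\updownarrow}=\Pi^\uparrow\cap\Pi^\downarrow$.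 Topology. Let $\mathbb R^2_{\rm c}=(\overline{\mathbb R}\times\mathbb R)\cup\{( *,-\infty),( *,\infty)\}$ with the compact metrisable topology inducing the product topology on $\overline{\mathbb R}\times\mathbb R$ and such that $(x_n,t_n)\to( *,\pm\infty)$ iff $t_n\to\pm\infty$. The interpolated graph of $f$ is $H(f)=\{(x,t):t\in I(f)\cap\mathbb R,\ x\text{ lies between }f(t-)\text{ and }f(t+)\text{ inclusive}\}\cup\{( *,t):t\in I(f)\cap\{\pm\infty\}\}\subseteq\mathbb R^2_{\rm c}$, totally ordered by $(x_1,t_1)\sqsubseteq(x_2,t_2)$ iff $t_1<t_2$, or $t_1=t_2$ and $x_1$ lies between $f(t_1-)$ and $x_2$ inclusive. Let $H^{(2)}(f)=\{(z_1,z_2)\in H(f)^2:z_1\sqsubseteq z_2\}$, a compact subset of $(\mathbb R^2_{\rm c})^2$. $\Pi$ carries the metric $d_\Pi(f,g)$ = Hausdorff distance between $H^{(2)}(f)$ and $H^{(2)}(g)$ (Skorohod's M1 topology). $\mathcal K(\Pi^\uparrow)$ is the set of nonempty compact subsets of $\Pi^\uparrow$ with the Hausdorff metric. Extension and crossing. $f\subseteq g$ ($g$ extends $f$) means $H^{(2)}(f)\subseteq H^{(2)}(g)$. Paths $f,g\in\Pi$ are non-crossing if there are $f',g'\in\Pi^{\updownarrow}$ with $f\subseteq f'$, $g\subseteq g'$ and either $f'(t\star)\le g'(t\star)$ for all $t\star\in\mathbb R_{\mathfrak s}$ or $g'(t\star)\le f'(t\star)$ for all $t\star\in\mathbb R_{\mathfrak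 s}$; otherwise they cross. A set of paths is non-crossing if all pairs of its elements are; a path does not cross $A$ if it crosses no element of $A$. For $f,g\in\Pi^\uparrow$, $f\vartriangleleft g$ means there are $f',g'\in\Pi^{\updownarrow}$ with $f\subseteq f'$, $g\subseteq g'$ and $f'(t\star)\le g'(t\star)$ for all $t\star\in\mathbb R_{\mathfrak s}$. A deterministic weave is a non-crossing $\mathcal A\in\mathcal K(\Pi^\uparrow)$ that is pervasive, i.e. every $z\in\mathbb R^2_{\rm c}$ lies in $H(f)$ for some $f\in\mathcal A$. $\mathrm{flow}(\mathcal A)=\{f\in\Pi^{\updownarrow}: f\text{ does not cross }\mathcal A\}$. $\mathcal A_{\max}$ is the set of $g\in\mathcal A$ such that $f\in\mathcal A$, $g\subseteq f$ implies $f=g$; $(\mathcal A_{\max},\vartriangleleft)$ is totally ordered. Cuts. A Dedekind cut of $\mathcal A_{\max}$ is a subset $X\subseteq\mathcal A_{\max}$ such that (i) if $f,g\in\mathcal A_{\max}$, $f\vartriangleleft g$ and $g\in X$, then $f\in X$; and (ii) $X$ has no maximal element (with respect to $\vartriangleleft$). For $h\in\Pi^\uparrow$ not crossing $\mathcal A$, $X_h=\{f\in\mathcal A_{\max}: f\vartriangleleft h,\ f\not\subseteq h,\ h\not\subseteq f\}$. For $f\in\Pi^\uparrow$ and $t\star\in\mathbb R_{\mathfrak s}$ put $L_{t\star}(f)=[-\infty,f(t\star))$ if $t\star\ge\sigma_f+$, or if $t\star=\sigma_f-$ and $f(\sigma_f+)<f(\sigma_f-)$; and $L_{t\star}(f)=\emptyset$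 otherwise. Put $L(f)=\bigcup_{t\star\in\mathbb R_{\mathfrak s}}L_{t\star}(f)\times\{t\star\}\subseteq\overline{\mathbb R}\times\mathbb R_{\mathfrak s}$. For a Dedekind cut $X$ let $L(X)=\bigcup_{f\in X}L(f)$, let $\overline{L(X)}$ be its closure in the product topology on $\overline{\mathbb R}\times\mathbb R_{\mathfrak s}$, and let $P_X(t\star)=\sup\{x\in\overline{\mathbb R}:(x,t\star)\in\overline{L(X)}\}$ for $t\star\in\mathbb R_{\mathfrak s}$ (with $\sup\emptyset=-\infty$), regarded as a bi-infinite path. *)

theory Defs
  imports "HOL-Analysis.Analysis"
begin

section \<open>Split time\<close>

text \<open>\<open>Minus t\<close> and \<open>Plus t\<close> are the points \<open>t-\<close> and \<open>t+\<close>, ordered lexicographically.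
  The split real line is \<open>real split_time\<close>; the split extended line \<open>ereal split_time\<close> is
  only used as an order.\<close>

datatype 'a split_time = is_Minus: Minus (base: 'a) | is_Plus: Plus (base: 'a)

instantiation split_time :: (linorder) linorder
begin

definition less_eq_split_time :: "'a split_time \<Rightarrow> 'a split_time \<Rightarrow> bool" where
  "s \<le> t \<longleftrightarrow> base s < base t \<or> (base s = base t \<and> (is_Plus s \<longrightarrow> is_Plus t))"

definition less_split_time :: "'a split_time \<Rightarrow> 'a split_time \<Rightarrow> bool" where
  "s < t \<longleftrightarrow> base s < base t \<or> (base s = base t \<and> is_Minus s \<and> is_Plus t)"

instance
proof
  fix x y z :: "'a split_time"
  show "x < y \<longleftrightarrow> x \<le> y \<and> \<not> y \<le> x"
    by (cases x; cases y) (auto simp: less_eq_split_time_def less_split_time_def)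
  show "x \<le> x"
    by (simp add: less_eq_split_time_def)
  show "x \<le> z" if "x \<le> y" "y \<le> z"
    using that by (auto simp: less_eq_split_time_def)
  show "x = y" if "x \<le> y" "y \<le> x"
    using that by (cases x; cases y) (auto simp: less_eq_split_time_def)
  show "x \<le> y \<or> y \<le> x"
    by (cases x; cases y) (auto simp: less_eq_split_time_def)
qed

end

instantiation split_time :: (linorder) linorder_topology
begin

definition open_split_time :: "'a split_time set \<Rightarrow> bool" where
  "open_split_time = generate_topology (range lessThan \<union> range greaterThan)"

instance
  by standard (rule open_split_time_def)

end


section \<open>The compactified space-time plane\<close>

text \<open>\<open>Pt x t\<close> is the point \<open>(x,t)\<close>; \<open>Pinf\<close> and \<open>Minf\<close> are \<open>(*,\<infinity>)\<close> and \<open>(*,-\<infinity>)\<close>.\<close>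

datatype spacetime = Pt ereal real | Pinf | Minf

definition time_of :: "spacetime \<Rightarrow> ereal" where
  "time_of z = (case z of Pt x t \<Rightarrow> ereal t | Pinf \<Rightarrow> \<infinity> | Minf \<Rightarrow> -\<infinity>)"

text \<open>The metric is pulled back from the Euclidean plane along \<open>st_embed\<close>, a bijection onto the
  closed diamond \<open>\<bar>a\<bar> + \<bar>b\<bar> \<le> 1\<close> that contracts each of the two lines at infinite time to a
  corner. The lemmas at the end of this section show that it induces the intended compact topology.
  Only this topology, and not the choice of metric, affects the topology on paths below.\<close>

definition squash :: "ereal \<Rightarrow> real" where
  "squash x = (case x of ereal r \<Rightarrow> r / (1 + \<bar>r\<bar>) | PInfty \<Rightarrow> 1 | MInfty \<Rightarrow> -1)"

definition st_embed :: "spacetime \<Rightarrow> real \<times> real" where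
  "st_embed z = ((case z of Pt x t \<Rightarrow> squash x / (1 + \<bar>t\<bar>) | Pinf \<Rightarrow> 0 | Minf \<Rightarrow> 0),
                 squash (time_of z))"

lemma squash_simps [simp]:
  "squash (ereal r) = r / (1 + \<bar>r\<bar>)" "squash \<infinity> = 1" "squash (-\<infinity>) = -1"
  by (simp_all add: squash_def)

lemma strict_mono_squash: "strict_mono squash"
proof (rule strict_monoI)
  have *: "r / (1 + \<bar>r\<bar>) < s / (1 + \<bar>s\<bar>)" if "r < s" for r s :: real
  proof -
    have "r * (1 + \<bar>s\<bar>) < s * (1 + \<bar>r\<bar>)"
    proof (cases "r < 0 \<and> 0 \<le> s")
      case True
      then have "r * s \<le> 0" by (simp add: mult_nonpos_nonneg)
      then show ?thesis using that True by (simp add: algebra_simps)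
    next
      case False
      then show ?thesis using that by (auto simp: abs_if algebra_simps)
    qed
    then show ?thesis
      by (simp add: pos_divide_less_eq pos_less_divide_eq)
  qed
  have **: "-1 < r / (1 + \<bar>r\<bar>)" "r / (1 + \<bar>r\<bar>) < 1" for r :: real
    by (auto simp: pos_less_divide_eq pos_divide_less_eq)
  fix x y :: ereal
  assume "x < y"
  then show "squash x < squash y"
    using * ** by (cases x; cases y) auto
qed

lemma squash_less_iff [simp]: "squash x < squash y \<longleftrightarrow> x < y"
  using strict_mono_less strict_mono_squash by blast

lemma squash_eq_iff [simp]: "squash x = squash y \<longleftrightarrow> x = y"
  using strict_mono_eq strict_mono_squash by blast

lemma abs_squash_le: "\<bar>squash x\<bar> \<le> 1"
  by (cases x) auto

lemma squash_surj:
  assumes "\<bar>a\<bar> \<le> 1"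
  obtains x where "squash x = a"
proof -
  consider "a = 1" | "a = -1" | "\<bar>a\<bar> < 1"
    using assms by linarith
  then show thesis
  proof cases
    case 3
    define u where "u = 1 - \<bar>a\<bar>"
    have u: "u > 0" using 3 by (simp add: u_def)
    have "1 + \<bar>a / u\<bar> = 1 / u"
      using u by (simp add: u_def field_simps abs_divide)
    then have "squash (ereal (a / u)) = a" using u by simp
    then show thesis by (rule that)
  qed (use that[of \<infinity>] that[of "-\<infinity>"] in auto)
qed

lemma tendsto_squash_iff:
  "((\<lambda>n. squash (x n)) \<longlongrightarrow> squash l) F \<longleftrightarrow> (x \<longlongrightarrow> l) F"
proof
  assume *: "((\<lambda>n. squash (x n)) \<longlongrightarrow> squash l) F"
  show "(x \<longlongrightarrow> l) F"
  proof (rule order_tendstoI)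
    fix a assume "a < l"
    then show "\<forall>\<^sub>F n in F. a < x n" using order_tendstoD(1)[OF *, of "squash a"] by simp
  next
    fix a assume "l < a"
    then show "\<forall>\<^sub>F n in F. x n < a" using order_tendstoD(2)[OF *, of "squash a"] by simp
  qed
next
  assume *: "(x \<longlongrightarrow> l) F"
  show "((\<lambda>n. squash (x n)) \<longlongrightarrow> squash l) F"
  proof (rule order_tendstoI)
    fix a assume a: "a < squash l"
    show "\<forall>\<^sub>F n in F. a < squash (x n)"
    proof (cases "a < -1")
      case True
      then have "a < squash (x n)" for n using abs_squash_le[of "x n"] by linarith
      then show ?thesis by simp
    next
      case False
      then have "\<bar>a\<bar> \<le> 1" using a abs_squash_le[of l] by linarith
      then obtain y where "squash y = a" by (rule squash_surj)
      then show ?thesis using order_tendstoD(1)[OF *, of y] a by auto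
    qed
  next
    fix a assume a: "squash l < a"
    show "\<forall>\<^sub>F n in F. squash (x n) < a"
    proof (cases "a > 1")
      case True
      then have "squash (x n) < a" for n using abs_squash_le[of "x n"] by linarith
      then show ?thesis by simp
    next
      case False
      then have "\<bar>a\<bar> \<le> 1" using a abs_squash_le[of l] by linarith
      then obtain y where "squash y = a" by (rule squash_surj)
      then show ?thesis using order_tendstoD(2)[OF *, of y] a by auto
    qed
  qed
qed

lemma st_embed_simps [simp]:
  "st_embed (Pt x t) = (squash x / (1 + \<bar>t\<bar>), squash (ereal t))"
  "st_embed Pinf = (0, 1)" "st_embed Minf = (0, -1)"
  by (simp_all add: st_embed_def time_of_def)

lemma squash_ereal_not_unit: "squash (ereal t) \<noteq> 1" "squash (ereal t) \<noteq> -1"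
  using squash_eq_iff[of "ereal t" "\<infinity>"] squash_eq_iff[of "ereal t" "-\<infinity>"] by auto

lemma inj_st_embed: "inj st_embed"
proof (rule injI)
  fix z w assume "st_embed z = st_embed w"
  then show "z = w"
    using squash_ereal_not_unit
    by (cases z; cases w) (auto simp del: squash_simps(1), (metis+)?)
qed

instantiation spacetime :: metric_space
begin

definition dist_spacetime :: "spacetime \<Rightarrow> spacetime \<Rightarrow> real" where
  "dist_spacetime z w = dist (st_embed z) (st_embed w)"

definition uniformity_spacetime :: "(spacetime \<times> spacetime) filter" where
  "uniformity_spacetime = (INF e\<in>{0<..}. principal {(z, w). dist z w < e})"

definition open_spacetime :: "spacetime set \<Rightarrow> bool" where
  "open_spacetime U \<longleftrightarrow> (\<forall>z\<in>U. \<forall>\<^sub>F (z', w) in uniformity. z' = z \<longrightarrow> w \<in> U)"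

instance
proof
  fix x y z :: spacetime
  show "dist x y = 0 \<longleftrightarrow> x = y"
    using inj_st_embed by (auto simp: dist_spacetime_def dest: injD)
  show "dist x y \<le> dist x z + dist y z"
    unfolding dist_spacetime_def by (rule dist_triangle2)
qed (simp_all add: uniformity_spacetime_def open_spacetime_def)

end

lemma tendsto_st_embed_iff:
  "((\<lambda>n. st_embed (z n)) \<longlongrightarrow> st_embed w) F \<longleftrightarrow> (z \<longlongrightarrow> w) F"
  by (simp add: tendsto_dist_iff[of z] tendsto_dist_iff[of "\<lambda>n. st_embed (z n)"] dist_spacetime_def)

lemma tendsto_Pt_iff:
  "((\<lambda>n. Pt (x n) (t n)) \<longlongrightarrow> Pt x0 t0) F \<longleftrightarrow> (x \<longlongrightarrow> x0) F \<and> (t \<longlongrightarrow> t0) F"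
proof -
  have t: "((\<lambda>n. squash (ereal (t n))) \<longlongrightarrow> squash (ereal t0)) F \<longleftrightarrow> (t \<longlongrightarrow> t0) F"
    by (simp only: tendsto_squash_iff lim_ereal)
  have x: "((\<lambda>n. squash (x n) / (1 + \<bar>t n\<bar>)) \<longlongrightarrow> squash x0 / (1 + \<bar>t0\<bar>)) F \<longleftrightarrow> (x \<longlongrightarrow> x0) F"
    if *: "(t \<longlongrightarrow> t0) F"
  proof
    assume "((\<lambda>n. squash (x n) / (1 + \<bar>t n\<bar>)) \<longlongrightarrow> squash x0 / (1 + \<bar>t0\<bar>)) F"
    then have "((\<lambda>n. squash (x n) / (1 + \<bar>t n\<bar>) * (1 + \<bar>t n\<bar>)) \<longlongrightarrow>
        squash x0 / (1 + \<bar>t0\<bar>) * (1 + \<bar>t0\<bar>)) F"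
      by (intro tendsto_mult[OF _ tendsto_add[OF tendsto_const tendsto_rabs[OF *]]])
    moreover have "1 + \<bar>r\<bar> \<noteq> 0" for r :: real by linarith
    ultimately have "((\<lambda>n. squash (x n)) \<longlongrightarrow> squash x0) F" by simp
    then show "(x \<longlongrightarrow> x0) F" by (simp only: tendsto_squash_iff)
  next
    assume "(x \<longlongrightarrow> x0) F"
    then have "((\<lambda>n. squash (x n)) \<longlongrightarrow> squash x0) F" by (simp only: tendsto_squash_iff)
    moreover have "1 + \<bar>t0\<bar> \<noteq> 0" by linarith
    ultimately show "((\<lambda>n. squash (x n) / (1 + \<bar>t n\<bar>)) \<longlongrightarrow> squash x0 / (1 + \<bar>t0\<bar>)) F"
      by (intro tendsto_divide[OF _ tendsto_add[OF tendsto_const tendsto_rabs[OF *]]])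
  qed
  have "((\<lambda>n. Pt (x n) (t n)) \<longlongrightarrow> Pt x0 t0) F \<longleftrightarrow>
      ((\<lambda>n. squash (x n) / (1 + \<bar>t n\<bar>)) \<longlongrightarrow> squash x0 / (1 + \<bar>t0\<bar>)) F \<and>
      ((\<lambda>n. squash (ereal (t n))) \<longlongrightarrow> squash (ereal t0)) F"
    unfolding tendsto_st_embed_iff[symmetric] st_embed_simps
    by (auto simp del: squash_simps simp: tendsto_Pair dest: tendsto_fst tendsto_snd)
  then show ?thesis using t x by blast
qed

lemma fst_st_embed_le: "\<bar>fst (st_embed z)\<bar> \<le> 1 - \<bar>snd (st_embed z)\<bar>"
proof (cases z)
  case (Pt x t)
  have "1 - \<bar>t / (1 + \<bar>t\<bar>)\<bar> = 1 / (1 + \<bar>t\<bar>)"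
    by (auto simp: divide_simps abs_if)
  then show ?thesis
    using abs_squash_le[of x] by (simp add: Pt abs_divide divide_right_mono)
qed auto

lemma tendsto_infinite_time_iff:
  "(z \<longlongrightarrow> Pinf) F \<longleftrightarrow> ((\<lambda>n. time_of (z n)) \<longlongrightarrow> \<infinity>) F" (is ?P)
  "(z \<longlongrightarrow> Minf) F \<longleftrightarrow> ((\<lambda>n. time_of (z n)) \<longlongrightarrow> -\<infinity>) F" (is ?M)
proof -
  have *: "((\<lambda>n. st_embed (z n)) \<longlongrightarrow> (0, c)) F \<longleftrightarrow> ((\<lambda>n. snd (st_embed (z n))) \<longlongrightarrow> c) F"
    if c: "\<bar>c\<bar> = 1" for c :: real
  proof
    assume s: "((\<lambda>n. snd (st_embed (z n))) \<longlongrightarrow> c) F"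
    then have "((\<lambda>n. 1 - \<bar>snd (st_embed (z n))\<bar>) \<longlongrightarrow> 1 - \<bar>c\<bar>) F"
      by (intro tendsto_diff tendsto_const tendsto_rabs)
    then have "((\<lambda>n. 1 - \<bar>snd (st_embed (z n))\<bar>) \<longlongrightarrow> 0) F"
      by (simp only: c diff_self)
    moreover have "\<forall>\<^sub>F n in F. norm (fst (st_embed (z n))) \<le> 1 - \<bar>snd (st_embed (z n))\<bar>"
      by (rule always_eventually) (simp only: real_norm_def fst_st_embed_le simp_thms)
    ultimately have "((\<lambda>n. fst (st_embed (z n))) \<longlongrightarrow> 0) F"
      by (rule Lim_null_comparison[rotated])
    from tendsto_Pair[OF this s] show "((\<lambda>n. st_embed (z n)) \<longlongrightarrow> (0, c)) F" by simp
  qed (auto dest: tendsto_snd)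
  have s: "snd (st_embed w) = squash (time_of w)" for w
    by (simp add: st_embed_def)
  have e: "st_embed Pinf = (0, squash \<infinity>)" "st_embed Minf = (0, squash (-\<infinity>))"
    by simp_all
  have "\<bar>squash \<infinity>\<bar> = 1" "\<bar>squash (-\<infinity>)\<bar> = 1"
    by simp_all
  from this[THEN *] show ?P ?M
    unfolding tendsto_st_embed_iff[of z, symmetric] e s tendsto_squash_iff by blast+
qed

lemma range_st_embed: "range st_embed = {(a, b). \<bar>a\<bar> + \<bar>b\<bar> \<le> 1}"
proof (intro equalityI subsetI)
  fix p assume "p \<in> range st_embed"
  then obtain z where "p = st_embed z" by blast
  then show "p \<in> {(a, b). \<bar>a\<bar> + \<bar>b\<bar> \<le> 1}"
    using fst_st_embed_le[of z] by (simp add: case_prod_beta)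
next
  fix p :: "real \<times> real" assume "p \<in> {(a, b). \<bar>a\<bar> + \<bar>b\<bar> \<le> 1}"
  then obtain a b where p: "p = (a, b)" and ab: "\<bar>a\<bar> + \<bar>b\<bar> \<le> 1" by auto
  obtain y where y: "squash y = b" using squash_surj[of b] ab by fastforce
  show "p \<in> range st_embed"
  proof (cases y)
    case (real t)
    have t: "1 - \<bar>b\<bar> = 1 / (1 + \<bar>t\<bar>)"
      using y real by (simp add: abs_divide field_simps flip: y)
    have "\<bar>a * (1 + \<bar>t\<bar>)\<bar> \<le> (1 - \<bar>b\<bar>) * (1 + \<bar>t\<bar>)"
      unfolding abs_mult using ab by (intro mult_mono) auto
    also have "\<dots> = 1" using t by simp
    finally obtain x where "squash x = a * (1 + \<bar>t\<bar>)" using squash_surj by blast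
    moreover have "1 + \<bar>t\<bar> \<noteq> 0" by linarith
    ultimately have "st_embed (Pt x t) = p" using p y real by simp
    then show ?thesis by blast
  next
    case PInf
    then have "st_embed Pinf = p" using p y ab by auto
    then show ?thesis by blast
  next
    case MInf
    then have "st_embed Minf = p" using p y ab by auto
    then show ?thesis by blast
  qed
qed

lemma compact_spacetime: "compact (UNIV :: spacetime set)"
proof -
  have "closed {p :: real \<times> real. \<bar>fst p\<bar> + \<bar>snd p\<bar> \<le> 1}"
    by (intro closed_Collect_le continuous_intros)
  moreover have "bounded {p :: real \<times> real. \<bar>fst p\<bar> + \<bar>snd p\<bar> \<le> 1}"
    by (rule boundedI[of _ 1]) (metis (mono_tags, lifting) mem_Collect_eq norm_Pair_le
        order_trans prod.collapse real_norm_def)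
  ultimately have c: "compact (range st_embed)"
    by (simp add: range_st_embed case_prod_beta' compact_eq_bounded_closed)
  show ?thesis
  proof (unfold compact_def, intro allI impI)
    fix f :: "nat \<Rightarrow> spacetime"
    obtain l r where lr: "l \<in> range st_embed" "strict_mono r" "((\<lambda>n. st_embed (f n)) \<circ> r) \<longlonglongrightarrow> l"
      using c unfolding compact_def by (metis rangeI)
    then obtain w where "l = st_embed w" by blast
    then have "(f \<circ> r) \<longlonglongrightarrow> w"
      using lr(3) tendsto_st_embed_iff[of "f \<circ> r" w sequentially] by (simp add: comp_def)
    then show "\<exists>l\<in>UNIV. \<exists>r. strict_mono r \<and> (f \<circ> r) \<longlonglongrightarrow> l" using lr(2) by blast
  qed
qed


section \<open>Paths\<close>

definition cadlag :: "ereal \<Rightarrow> ereal \<Rightarrow> (real split_time \<Rightarrow> ereal) \<Rightarrow> bool" where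
  "cadlag \<sigma> \<tau> v \<longleftrightarrow>
     (\<forall>t. \<sigma> \<le> ereal t \<and> ereal t < \<tau> \<longrightarrow>
        ((\<lambda>s. v (Plus s)) \<longlongrightarrow> v (Plus t)) (at_right t) \<and>
        ((\<lambda>s. v (Minus s)) \<longlongrightarrow> v (Plus t)) (at_right t)) \<and>
     (\<forall>t. \<sigma> < ereal t \<and> ereal t \<le> \<tau> \<longrightarrow>
        ((\<lambda>s. v (Plus s)) \<longlongrightarrow> v (Minus t)) (at_left t) \<and>
        ((\<lambda>s. v (Minus s)) \<longlongrightarrow> v (Minus t)) (at_left t))"

text \<open>A path is its initial time, its final time and its value function. The latter is made
  \<^const>\<open>extensional\<close>, so that equal paths are those with equal domains and equal values there.\<close>

typedef path =
  "{(\<sigma>, \<tau>, v). \<sigma> \<le> \<tau> \<and> cadlag \<sigma> \<tau> v \<and> v \<in> extensional {s. \<sigma> \<le> ereal (base s) \<and> ereal (base s) \<le> \<tau>}}"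
proof
  show "(\<infinity>, \<infinity>, \<lambda>_. undefined) \<in> {(\<sigma>, \<tau>, v). \<sigma> \<le> \<tau> \<and> cadlag \<sigma> \<tau> v \<and>
      v \<in> extensional {s. \<sigma> \<le> ereal (base s) \<and> ereal (base s) \<le> \<tau>}}"
    by (auto simp: cadlag_def)
qed

setup_lifting type_definition_path

lift_definition start_time :: "path \<Rightarrow> ereal" is "\<lambda>(\<sigma>, \<tau>, v). \<sigma>" .

lift_definition end_time :: "path \<Rightarrow> ereal" is "\<lambda>(\<sigma>, \<tau>, v). \<tau>" .

lift_definition path_val :: "path \<Rightarrow> real split_time \<Rightarrow> ereal" is "\<lambda>(\<sigma>, \<tau>, v). v" .

definition paths_up :: "path set" where
  "paths_up = {f. end_time f = \<infinity>}"

definition paths_down :: "path set" where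
  "paths_down = {f. start_time f = -\<infinity>}"

definition paths_updown :: "path set" where
  "paths_updown = paths_up \<inter> paths_down"

text \<open>A function on the split real line regarded as a bi-infinite path; meaningful only if
  \<open>cadlag (-\<infinity>) \<infinity> v\<close> holds.\<close>

definition biinfinite_path :: "(real split_time \<Rightarrow> ereal) \<Rightarrow> path" where
  "biinfinite_path v = Abs_path (-\<infinity>, \<infinity>, v)"

lemma biinfinite_path:
  assumes "cadlag (-\<infinity>) \<infinity> v"
  shows "biinfinite_path v \<in> paths_updown" "path_val (biinfinite_path v) = v"
proof -
  have "Rep_path (biinfinite_path v) = (-\<infinity>, \<infinity>, v)"
    unfolding biinfinite_path_def
    by (rule Abs_path_inverse) (use assms in \<open>auto simp: extensional_def\<close>)
  then show "biinfinite_path v \<in> paths_updown" "path_val (biinfinite_path v) = v"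
    by (simp_all add: paths_updown_def paths_up_def paths_down_def start_time.rep_eq
        end_time.rep_eq path_val.rep_eq)
qed


section \<open>The M1 topology on paths\<close>

definition in_between :: "ereal \<Rightarrow> ereal \<Rightarrow> ereal \<Rightarrow> bool" where
  "in_between a b x \<longleftrightarrow> min a b \<le> x \<and> x \<le> max a b"

definition graph :: "path \<Rightarrow> spacetime set" where
  "graph f =
     {Pt x t | x t. start_time f \<le> ereal t \<and> ereal t \<le> end_time f \<and>
        in_between (path_val f (Minus t)) (path_val f (Plus t)) x}
     \<union> {z. z = Pinf \<and> end_time f = \<infinity>}
     \<union> {z. z = Minf \<and> start_time f = -\<infinity>}"

text \<open>At equal times \<open>\<plusminus>\<infinity>\<close> the two points are the same, and they are comparable.\<close>

definition graph_le :: "path \<Rightarrow> spacetime \<Rightarrow> spacetime \<Rightarrow> bool" where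
  "graph_le f z1 z2 \<longleftrightarrow> time_of z1 < time_of z2 \<or>
     (case (z1, z2) of
        (Pt x1 t1, Pt x2 t2) \<Rightarrow> t1 = t2 \<and> in_between (path_val f (Minus t1)) x2 x1
      | _ \<Rightarrow> z1 = z2)"

definition graph2 :: "path \<Rightarrow> (spacetime \<times> spacetime) set" where
  "graph2 f = {(z1, z2). z1 \<in> graph f \<and> z2 \<in> graph f \<and> graph_le f z1 z2}"

definition hausdorff_dist :: "'a::metric_space set \<Rightarrow> 'a set \<Rightarrow> real" where
  "hausdorff_dist A B = max (SUP a\<in>A. infdist a B) (SUP b\<in>B. infdist b A)"

text \<open>Open sets are those of the metric \<open>dist_path\<close>; \<^const>\<open>compact\<close> on sets of paths refers to
  this topology.\<close>

instantiation path :: "{dist, topological_space}"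
begin

definition dist_path :: "path \<Rightarrow> path \<Rightarrow> real" where
  "dist_path f g = hausdorff_dist (graph2 f) (graph2 g)"

definition open_path :: "path set \<Rightarrow> bool" where
  "open_path U \<longleftrightarrow> (\<forall>f\<in>U. \<exists>e>0. \<forall>g. dist f g < e \<longrightarrow> g \<in> U)"

instance
proof
  show "open (UNIV :: path set)"
    by (auto simp: open_path_def intro: zero_less_one)
  show "open (S \<inter> T)" if ST: "open S" "open T" for S T :: "path set"
    unfolding open_path_def
  proof
    fix f assume "f \<in> S \<inter> T"
    then obtain d e where "d > 0" "\<forall>g. dist f g < d \<longrightarrow> g \<in> S" "e > 0" "\<forall>g. dist f g < e \<longrightarrow> g \<in> T"
      using ST unfolding open_path_def by (metis IntD1 IntD2)
    then show "\<exists>e>0. \<forall>g. dist f g < e \<longrightarrow> g \<in> S \<inter> T"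
      by (intro exI[of _ "min d e"]) auto
  qed
  show "open (\<Union>K)" if "\<forall>S\<in>K. open S" for K :: "path set set"
    using that unfolding open_path_def by (meson Union_iff)
qed

end


section \<open>Extension, crossing and deterministic weaves\<close>

definition extended_by :: "path \<Rightarrow> path \<Rightarrow> bool" where
  "extended_by f g \<longleftrightarrow> graph2 f \<subseteq> graph2 g"

definition below :: "path \<Rightarrow> path \<Rightarrow> bool" where
  "below f g \<longleftrightarrow> (\<exists>f'\<in>paths_updown. \<exists>g'\<in>paths_updown. extended_by f f' \<and> extended_by g g' \<and>
     (\<forall>s. path_val f' s \<le> path_val g' s))"

definition crosses :: "path \<Rightarrow> path \<Rightarrow> bool" where
  "crosses f g \<longleftrightarrow> \<not> (\<exists>f'\<in>paths_updown. \<exists>g'\<in>paths_updown. extended_by f f' \<and> extended_by g g' \<and>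
     ((\<forall>s. path_val f' s \<le> path_val g' s) \<or> (\<forall>s. path_val g' s \<le> path_val f' s)))"

definition crosses_set :: "path \<Rightarrow> path set \<Rightarrow> bool" where
  "crosses_set f A \<longleftrightarrow> (\<exists>g\<in>A. crosses f g)"

definition deterministic_weave :: "path set \<Rightarrow> bool" where
  "deterministic_weave A \<longleftrightarrow>
     A \<subseteq> paths_up \<and> A \<noteq> {} \<and> compact A \<and>
     (\<forall>f\<in>A. \<forall>g\<in>A. \<not> crosses f g) \<and>
     (\<forall>z. \<exists>f\<in>A. z \<in> graph f)"

definition flow :: "path set \<Rightarrow> path set" where
  "flow A = {f \<in> paths_updown. \<not> crosses_set f A}"

definition max_paths :: "path set \<Rightarrow> path set" where
  "max_paths A = {g \<in> A. \<forall>f\<in>A. extended_by g f \<longrightarrow> f = g}"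


section \<open>Cuts\<close>

definition dedekind_cuts :: "path set \<Rightarrow> path set set" where
  "dedekind_cuts A = {X. X \<subseteq> max_paths A \<and>
     (\<forall>f\<in>max_paths A. \<forall>g\<in>max_paths A. below f g \<and> g \<in> X \<longrightarrow> f \<in> X) \<and>
     \<not> (\<exists>m\<in>X. \<forall>g\<in>X. below m g \<longrightarrow> g = m)}"

definition cut_of :: "path set \<Rightarrow> path \<Rightarrow> path set" where
  "cut_of A h = {f \<in> max_paths A. below f h \<and> \<not> extended_by f h \<and> \<not> extended_by h f}"

definition lower_slice :: "path \<Rightarrow> real split_time \<Rightarrow> ereal set" where
  "lower_slice f s =
     (if map_split_time ereal s \<ge> Plus (start_time f) \<or>
         (map_split_time ereal s = Minus (start_time f) \<and>
          path_val f (Plus (base s)) < path_val f (Minus (base s)))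
      then {..<path_val f s} else {})"

definition lower_set :: "path \<Rightarrow> (ereal \<times> real split_time) set" where
  "lower_set f = {(x, s). x \<in> lower_slice f s}"

definition cut_lower_set :: "path set \<Rightarrow> (ereal \<times> real split_time) set" where
  "cut_lower_set X = (\<Union>f\<in>X. lower_set f)"

definition cut_boundary :: "path set \<Rightarrow> real split_time \<Rightarrow> ereal" where
  "cut_boundary X s = Sup {x. (x, s) \<in> closure (cut_lower_set X)}"

end

theory Submission
  imports Defs
begin

text \<open>A path \<open>f\<close> is encoded by the pointwise bounds \<open>lower_val f \<le> f' \<le> upper_val f\<close> that
  characterise its bi-infinite extensions \<open>f'\<close>. Then \<open>f \<subseteq> g\<close> means that the interval of \<open>g\<close> is
  contained in that of \<open>f\<close>, and \<open>f \<triangleleft> g\<close> means \<open>lower_val f \<le> upper_val g\<close>, so crossings are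
  detected at single split times. The cut boundary is the upper semicontinuous hull of the lower values
  of the paths in the cut.

  Compactness enters in two ways: it provides maximal extensions, and a sequence of paths moving from
  level \<open>b\<close> to level \<open>a\<close> in a time window shrinking to \<open>t\<close> has as limit a path jumping across
  \<open>[a,b]\<close> at \<open>t\<close>. Two opposite jumps at the same time across overlapping levels cross. This rules
  out oscillations of the cut boundary, and it rules out that the initial jump of a path is overtaken by
  paths passing just before it. Everything else follows by looking at paths through well-chosen points,
  which exist by pervasiveness.\<close>

section \<open>Lower and upper values of a path\<close>

text \<open>Three obstacles shape the argument. A point (x, r) on a path constrains its value at r-
  or at r+, and pervasiveness gives no choice between them. A strict inequality at a split time s is
  therefore first carried to all nearby times r on the correct side of s, where r- and r+ are both
  under control, and only then is a path taken through a point at time r. Carrying it over is not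
  automatic at an initial time t-: there a bound of a path can be finite while it is infinite just
  before, so it is not semicontinuous in the direction required, and opposite jumps have to be
  excluded. Finally, the order is not transitive, since a path puts no constraint on others before
  it starts. What survives is antisymmetry up to extension and a statement about cycles of three
  paths. The first turns X_h into the set of maximal paths strictly below h, and together they make
  this set closed downwards.\<close>

lemma path_cadlag: "cadlag (start_time f) (end_time f) (path_val f)"
  by transfer auto

lemma start_time_le_end_time: "start_time f \<le> end_time f"
  by transfer auto

lemma path_val_outside:
  "\<not> (start_time f \<le> ereal (base s) \<and> ereal (base s) \<le> end_time f) \<Longrightarrow> path_val f s = undefined"
  by transfer (auto simp: extensional_def)

lemma path_eqI:
  assumes "start_time f = start_time g" "end_time f = end_time g"
    and "\<And>s. start_time f \<le> ereal (base s) \<Longrightarrow> ereal (base s) \<le> end_time f \<Longrightarrow> path_val f s = path_val g s"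
  shows "f = g"
proof -
  have "path_val f s = path_val g s" for s
    using assms path_val_outside[of f s] path_val_outside[of g s] by metis
  then have "path_val f = path_val g" by blast
  then have "Rep_path f = Rep_path g"
    using assms(1,2) by (simp add: start_time.rep_eq end_time.rep_eq path_val.rep_eq case_prod_beta prod_eq_iff)
  then show ?thesis by (simp add: Rep_path_inject)
qed

text \<open>For a path in \<open>paths_up\<close>, the value at these split times is a one-sided
  limit taken within the domain. The only split time of the domain left out is the initial t-, where
  the value is free.\<close>

definition active :: "path \<Rightarrow> real split_time \<Rightarrow> bool" where
  "active f s \<longleftrightarrow> start_time f < ereal (base s) \<or> (start_time f = ereal (base s) \<and> is_Plus s)"

text \<open>An extension f' agrees with f at \<sigma>+, and f(\<sigma>-) must lie between
  f'(\<sigma>-) and f(\<sigma>+). An initial jump downwards thus forces f'(\<sigma>-) \<ge>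
  f(\<sigma>-) and leaves it free above; a jump upwards does the reverse; without a jump
  f'(\<sigma>-) is unconstrained.\<close>

definition lower_val :: "path \<Rightarrow> real split_time \<Rightarrow> ereal" where
  "lower_val f s =
     (if active f s \<or> (start_time f = ereal (base s) \<and>
          path_val f (Plus (base s)) < path_val f (Minus (base s)))
      then path_val f s else -\<infinity>)"

definition upper_val :: "path \<Rightarrow> real split_time \<Rightarrow> ereal" where
  "upper_val f s =
     (if active f s \<or> (start_time f = ereal (base s) \<and>
          path_val f (Minus (base s)) < path_val f (Plus (base s)))
      then path_val f s else \<infinity>)"

lemma active_simps [simp]:
  "active f (Plus t) \<longleftrightarrow> start_time f \<le> ereal t"
  "active f (Minus t) \<longleftrightarrow> start_time f < ereal t"
  by (auto simp: active_def)

lemma lower_slice_eq: "lower_slice f s = {..<lower_val f s}"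
proof -
  have "map_split_time ereal s \<ge> Plus (start_time f) \<longleftrightarrow> active f s"
    by (cases s) (auto simp: less_eq_split_time_def)
  moreover have "map_split_time ereal s = Minus (start_time f) \<longleftrightarrow>
      start_time f = ereal (base s) \<and> \<not> active f s"
    by (cases s) auto
  ultimately show ?thesis
    by (auto simp: lower_slice_def lower_val_def)
qed

lemma cut_lower_set_eq: "cut_lower_set X = {(x, s). \<exists>f\<in>X. x < lower_val f s}"
  by (auto simp: cut_lower_set_def lower_set_def lower_slice_eq)

lemma active_vals [simp]:
  "active f s \<Longrightarrow> lower_val f s = path_val f s"
  "active f s \<Longrightarrow> upper_val f s = path_val f s"
  by (simp_all add: lower_val_def upper_val_def)

lemma lower_le_upper: "lower_val f s \<le> upper_val f s"
  by (auto simp: lower_val_def upper_val_def)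

lemma lower_val_notD:
  assumes "lower_val f s \<noteq> -\<infinity>"
  shows "lower_val f s = path_val f s" "start_time f \<le> ereal (base s)"
  using assms by (auto simp: lower_val_def active_def split: if_splits)

lemma upper_val_notD:
  assumes "upper_val f s \<noteq> \<infinity>"
  shows "upper_val f s = path_val f s" "start_time f \<le> ereal (base s)"
  using assms by (auto simp: upper_val_def active_def split: if_splits)

lemma before_vals:
  assumes "ereal (base s) < start_time f"
  shows "lower_val f s = -\<infinity>" "upper_val f s = \<infinity>"
  using assms by (auto simp: lower_val_def upper_val_def active_def)

lemma start_vals:
  assumes "start_time f = ereal t"
  shows "lower_val f (Minus t) = (if path_val f (Plus t) < path_val f (Minus t) then path_val f (Minus t) else -\<infinity>)"
    and "upper_val f (Minus t) = (if path_val f (Minus t) < path_val f (Plus t) then path_val f (Minus t) else \<infinity>)"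
  using assms by (auto simp: lower_val_def upper_val_def)

text \<open>At the initial t- at least one bound is infinite, so equality there means that the value
  itself is that infinity. Before the start the bounds differ. Equality thus detects that the path
  has started, which recovers domain and values from the bounds.\<close>

lemma eq_valsD:
  assumes "lower_val f s = upper_val f s"
  shows "start_time f \<le> ereal (base s)" "path_val f s = lower_val f s"
  using assms by (auto simp: lower_val_def upper_val_def active_def split: if_splits)

section \<open>One-sided limits at a split time\<close>

definition side :: "real split_time \<Rightarrow> real filter" where
  "side s = (case s of Minus t \<Rightarrow> at_left t | Plus t \<Rightarrow> at_right t)"

lemma side_simps [simp]: "side (Minus t) = at_left t" "side (Plus t) = at_right t"
  by (simp_all add: side_def)

lemma side_nontrivial [simp]: "side s \<noteq> bot"
  by (cases s) auto

lemma active_tendsto: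
  assumes "f \<in> paths_up" "active f s"
  shows "((\<lambda>r. path_val f (Plus r)) \<longlongrightarrow> path_val f s) (side s)"
    and "((\<lambda>r. path_val f (Minus r)) \<longlongrightarrow> path_val f s) (side s)"
  using assms path_cadlag[of f] by (cases s; auto simp: cadlag_def paths_up_def)+

lemma eventually_side_active:
  assumes "active f s"
  shows "\<forall>\<^sub>F r in side s. active f (Minus r)"
proof (cases s)
  case (Minus t)
  with assms have "start_time f < ereal t" by simp
  then obtain u where u: "start_time f < ereal u" "u < t"
    using ereal_dense2[of "start_time f" "ereal t"] by auto
  have "\<forall>\<^sub>F r in at_left t. u < r"
    using u(2) by (auto simp: eventually_at_left[of u])
  then show ?thesis using u(1) Minus
    by (cases "start_time f") (auto elim!: eventually_mono)
next
  case (Plus t)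
  have "\<forall>\<^sub>F r in at_right t. t < r"
    by (simp add: eventually_at_right_less)
  then show ?thesis using assms Plus
    by (auto elim!: eventually_mono intro: order_le_less_trans)
qed

lemma eventually_side_vals:
  assumes f: "f \<in> paths_up" "active f s"
  shows "y < path_val f s \<Longrightarrow> \<forall>\<^sub>F r in side s. active f (Minus r) \<and> y < path_val f (Minus r) \<and> y < path_val f (Plus r)"
    and "path_val f s < y \<Longrightarrow> \<forall>\<^sub>F r in side s. active f (Minus r) \<and> path_val f (Minus r) < y \<and> path_val f (Plus r) < y"
  using order_tendstoD[OF active_tendsto(1)[OF f]] order_tendstoD[OF active_tendsto(2)[OF f]]
    eventually_side_active[OF f(2)]
  by (auto simp: eventually_conj_iff)

section \<open>Compactness\<close>

lemma graph2_nonempty: "graph2 f \<noteq> {}"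
proof (cases "start_time f")
  case (real t)
  then have "(Pt (path_val f (Minus t)) t, Pt (path_val f (Minus t)) t) \<in> graph2 f"
    using start_time_le_end_time[of f]
    by (auto simp: graph2_def graph_def graph_le_def in_between_def)
  then show ?thesis by blast
next
  case PInf
  then have "(Pinf, Pinf) \<in> graph2 f"
    using start_time_le_end_time[of f]
    by (auto simp: graph2_def graph_def graph_le_def)
  then show ?thesis by blast
next
  case MInf
  then have "(Minf, Minf) \<in> graph2 f"
    by (auto simp: graph2_def graph_def graph_le_def)
  then show ?thesis by blast
qed

section \<open>Closedness of the ordered graph\<close>

lemma Pt_graph_iff:
  assumes "f \<in> paths_up"
  shows "Pt x t \<in> graph f \<longleftrightarrow> start_time f \<le> ereal t \<and>
    in_between (path_val f (Minus t)) (path_val f (Plus t)) x"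
  using assms by (auto simp: graph_def paths_up_def)

lemma time_of_simps [simp]:
  "time_of (Pt x t) = ereal t" "time_of Pinf = \<infinity>" "time_of Minf = -\<infinity>"
  by (simp_all add: time_of_def)

lemma Pt_graph2_iff:
  assumes "f \<in> paths_up"
  shows "(Pt x t, Pt y u) \<in> graph2 f \<longleftrightarrow> Pt x t \<in> graph f \<and> Pt y u \<in> graph f \<and>
    (t < u \<or> (t = u \<and> in_between (path_val f (Minus t)) y x))"
  by (auto simp: graph2_def graph_le_def)

lemma tendsto_time_of:
  assumes "(z \<longlongrightarrow> w) F"
  shows "((\<lambda>n. time_of (z n)) \<longlongrightarrow> time_of w) F"
proof -
  have "((\<lambda>n. snd (st_embed (z n))) \<longlongrightarrow> snd (st_embed w)) F"
    using assms by (intro tendsto_snd) (simp add: tendsto_st_embed_iff)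
  then show ?thesis by (simp add: st_embed_def tendsto_squash_iff)
qed

lemma tendsto_Pt_obtain:
  assumes "(z \<longlongrightarrow> Pt x t) F"
  obtains x' t' where "\<forall>\<^sub>F n in F. z n = Pt (x' n) (t' n)" "(x' \<longlongrightarrow> x) F" "(t' \<longlongrightarrow> t) F"
proof -
  \<comment> \<open>The default 0 at infinite times is arbitrary: the limit has a finite time, so
    these cases eventually stop occurring.\<close>
  define x' where "x' n = (case z n of Pt a b \<Rightarrow> a | _ \<Rightarrow> 0)" for n
  define t' where "t' n = (case z n of Pt a b \<Rightarrow> b | _ \<Rightarrow> 0)" for n
  have T: "((\<lambda>n. time_of (z n)) \<longlongrightarrow> ereal t) F"
    using tendsto_time_of[OF assms] by simp
  have ev: "\<forall>\<^sub>F n in F. z n = Pt (x' n) (t' n)"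
    using order_tendstoD(1)[OF T, of "-\<infinity>", simplified] order_tendstoD(2)[OF T, of "\<infinity>", simplified]
  proof eventually_elim
    case (elim n)
    then show ?case by (cases "z n") (auto simp: x'_def t'_def)
  qed
  have "((\<lambda>n. Pt (x' n) (t' n)) \<longlongrightarrow> Pt x t) F"
    using Lim_transform_eventually[OF assms ev] .
  then show thesis using that ev by (simp add: tendsto_Pt_iff)
qed

text \<open>Stated over \<open>nhds t\<close>, so that it applies along any sequence of times
  tending to t, whichever side the times lie on. The guard on \<open>start_time\<close> covers a
  path that starts at t, whose value at t- says nothing about earlier times.\<close>

lemma eventually_near_less:
  assumes "f \<in> paths_up"
  shows "path_val f (Minus t) < m \<Longrightarrow>
      \<forall>\<^sub>F r in nhds t. r < t \<longrightarrow> start_time f \<le> ereal r \<longrightarrow> path_val f (Minus r) < m \<and> path_val f (Plus r) < m"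
    and "start_time f \<le> ereal t \<Longrightarrow> path_val f (Plus t) < m \<Longrightarrow>
      \<forall>\<^sub>F r in nhds t. r > t \<longrightarrow> path_val f (Minus r) < m \<and> path_val f (Plus r) < m"
proof -
  assume *: "path_val f (Minus t) < m"
  have "\<forall>\<^sub>F r in at_left t. start_time f \<le> ereal r \<longrightarrow> path_val f (Minus r) < m \<and> path_val f (Plus r) < m"
  proof (cases "start_time f < ereal t")
    case True
    then show ?thesis
      using eventually_side_vals(2)[OF assms, of "Minus t" m] * by (auto elim: eventually_mono)
  next
    case False
    then have "\<forall>r<t. \<not> start_time f \<le> ereal r"
      by (metis less_ereal.simps(1) not_le order.strict_trans1)
    moreover have "\<forall>\<^sub>F r in at_left t. r < t"
      by (simp add: eventually_at_filter)
    ultimately show ?thesis by (auto elim: eventually_mono)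
  qed
  then show "\<forall>\<^sub>F r in nhds t. r < t \<longrightarrow> start_time f \<le> ereal r \<longrightarrow> path_val f (Minus r) < m \<and> path_val f (Plus r) < m"
    by (simp add: eventually_at_filter eventually_mono)
next
  assume "start_time f \<le> ereal t" "path_val f (Plus t) < m"
  then have "\<forall>\<^sub>F r in at_right t. path_val f (Minus r) < m \<and> path_val f (Plus r) < m"
    using eventually_side_vals(2)[OF assms, of "Plus t" m] by (auto elim: eventually_mono)
  then show "\<forall>\<^sub>F r in nhds t. r > t \<longrightarrow> path_val f (Minus r) < m \<and> path_val f (Plus r) < m"
    by (simp add: eventually_at_filter eventually_mono)
qed

lemma eventually_near_greater:
  assumes "f \<in> paths_up"
  shows "m < path_val f (Minus t) \<Longrightarrow>
      \<forall>\<^sub>F r in nhds t. r < t \<longrightarrow> start_time f \<le> ereal r \<longrightarrow> m < path_val f (Minus r) \<and> m < path_val f (Plus r)"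
    and "start_time f \<le> ereal t \<Longrightarrow> m < path_val f (Plus t) \<Longrightarrow>
      \<forall>\<^sub>F r in nhds t. r > t \<longrightarrow> m < path_val f (Minus r) \<and> m < path_val f (Plus r)"
proof -
  assume *: "m < path_val f (Minus t)"
  have "\<forall>\<^sub>F r in at_left t. start_time f \<le> ereal r \<longrightarrow> m < path_val f (Minus r) \<and> m < path_val f (Plus r)"
  proof (cases "start_time f < ereal t")
    case True
    then show ?thesis
      using eventually_side_vals(1)[OF assms, of "Minus t" m] * by (auto elim: eventually_mono)
  next
    case False
    then have "\<forall>r<t. \<not> start_time f \<le> ereal r"
      by (metis less_ereal.simps(1) not_le order.strict_trans1)
    moreover have "\<forall>\<^sub>F r in at_left t. r < t"
      by (simp add: eventually_at_filter)
    ultimately show ?thesis by (auto elim: eventually_mono)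
  qed
  then show "\<forall>\<^sub>F r in nhds t. r < t \<longrightarrow> start_time f \<le> ereal r \<longrightarrow> m < path_val f (Minus r) \<and> m < path_val f (Plus r)"
    by (simp add: eventually_at_filter eventually_mono)
next
  assume "start_time f \<le> ereal t" "m < path_val f (Plus t)"
  then have "\<forall>\<^sub>F r in at_right t. m < path_val f (Minus r) \<and> m < path_val f (Plus r)"
    using eventually_side_vals(1)[OF assms, of "Plus t" m] by (auto elim: eventually_mono)
  then show "\<forall>\<^sub>F r in nhds t. r > t \<longrightarrow> m < path_val f (Minus r) \<and> m < path_val f (Plus r)"
    by (simp add: eventually_at_filter eventually_mono)
qed

lemma graph_limit:
  assumes f: "f \<in> paths_up" and z: "\<And>n. z n \<in> graph f" "z \<longlonglongrightarrow> w"
  shows "w \<in> graph f"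
proof -
  have st: "start_time f \<le> time_of (z n)" for n
    using z(1)[of n] start_time_le_end_time[of f] by (auto simp: graph_def)
  then have stw: "start_time f \<le> time_of w"
    using tendsto_time_of[OF z(2)] by (intro LIMSEQ_le_const) auto
  show ?thesis
  proof (cases w)
    case (Pt x t)
    with z(2) have "z \<longlonglongrightarrow> Pt x t" by simp
    then obtain x' t' where ev: "\<forall>\<^sub>F n in sequentially. z n = Pt (x' n) (t' n)"
      and lim: "x' \<longlonglongrightarrow> x" "t' \<longlonglongrightarrow> t" by (rule tendsto_Pt_obtain)
    have st': "start_time f \<le> ereal t" using stw Pt by simp
    let ?a = "path_val f (Minus t)" and ?b = "path_val f (Plus t)"
    have "x \<le> max ?a ?b"
    proof (rule ccontr)
      assume "\<not> x \<le> max ?a ?b"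
      then obtain m where m: "max ?a ?b < m" "m < x" by (meson dense not_le)
      have "\<forall>\<^sub>F r in nhds t. (r < t \<longrightarrow> start_time f \<le> ereal r \<longrightarrow> path_val f (Minus r) < m \<and> path_val f (Plus r) < m)
          \<and> (r > t \<longrightarrow> path_val f (Minus r) < m \<and> path_val f (Plus r) < m)"
        using eventually_near_less[OF f, where m=m and t=t] m st' by (auto simp: eventually_conj_iff)
      then have "\<forall>\<^sub>F n in sequentially. (t' n < t \<longrightarrow> start_time f \<le> ereal (t' n) \<longrightarrow> path_val f (Minus (t' n)) < m \<and> path_val f (Plus (t' n)) < m)
          \<and> (t' n > t \<longrightarrow> path_val f (Minus (t' n)) < m \<and> path_val f (Plus (t' n)) < m)"
        by (rule lim(2)[unfolded filterlim_iff, rule_format])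
      then have "\<forall>\<^sub>F n in sequentially. False"
        using ev order_tendstoD(1)[OF lim(1) m(2)]
      proof eventually_elim
        case (elim n)
        then have "start_time f \<le> ereal (t' n)" "in_between (path_val f (Minus (t' n))) (path_val f (Plus (t' n))) (x' n)"
          using z(1)[of n] by (simp_all add: Pt_graph_iff[OF f])
        then show ?case using elim m(1)
          by (cases "t' n" t rule: linorder_cases) (auto simp: in_between_def max_def split: if_splits)
      qed
      then show False by simp
    qed
    moreover have "min ?a ?b \<le> x"
    proof (rule ccontr)
      assume "\<not> min ?a ?b \<le> x"
      then obtain m where m: "m < min ?a ?b" "x < m" by (meson dense not_le)
      have "\<forall>\<^sub>F r in nhds t. (r < t \<longrightarrow> start_time f \<le> ereal r \<longrightarrow> m < path_val f (Minus r) \<and> m < path_val f (Plus r))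
          \<and> (r > t \<longrightarrow> m < path_val f (Minus r) \<and> m < path_val f (Plus r))"
        using eventually_near_greater[OF f, where m=m and t=t] m st' by (auto simp: eventually_conj_iff)
      then have "\<forall>\<^sub>F n in sequentially. (t' n < t \<longrightarrow> start_time f \<le> ereal (t' n) \<longrightarrow> m < path_val f (Minus (t' n)) \<and> m < path_val f (Plus (t' n)))
          \<and> (t' n > t \<longrightarrow> m < path_val f (Minus (t' n)) \<and> m < path_val f (Plus (t' n)))"
        by (rule lim(2)[unfolded filterlim_iff, rule_format])
      then have "\<forall>\<^sub>F n in sequentially. False"
        using ev order_tendstoD(2)[OF lim(1) m(2)]
      proof eventually_elim
        case (elim n)
        then have "start_time f \<le> ereal (t' n)" "in_between (path_val f (Minus (t' n))) (path_val f (Plus (t' n))) (x' n)"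
          using z(1)[of n] by (simp_all add: Pt_graph_iff[OF f])
        then show ?case using elim m(1)
          by (cases "t' n" t rule: linorder_cases) (auto simp: in_between_def min_def split: if_splits)
      qed
      then show False by simp
    qed
    ultimately show ?thesis using st' by (simp add: Pt Pt_graph_iff[OF f] in_between_def)
  next
    case Pinf
    then show ?thesis using f by (simp add: graph_def paths_up_def)
  next
    case Minf
    then show ?thesis using stw by (simp add: graph_def)
  qed
qed

lemma closed_graph2:
  assumes f: "f \<in> paths_up"
  shows "closed (graph2 f)"
  unfolding closed_sequential_limits
proof (intro allI impI, elim conjE)
  fix p :: "nat \<Rightarrow> spacetime \<times> spacetime" and l
  assume p: "\<forall>n. p n \<in> graph2 f" and lim: "p \<longlonglongrightarrow> l"
  obtain z w where l: "l = (z, w)" by (cases l)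
  have z: "(\<lambda>n. fst (p n)) \<longlonglongrightarrow> z" and w: "(\<lambda>n. snd (p n)) \<longlonglongrightarrow> w"
    using tendsto_fst[OF lim] tendsto_snd[OF lim] l by auto
  have pg: "fst (p n) \<in> graph f" "snd (p n) \<in> graph f" "graph_le f (fst (p n)) (snd (p n))" for n
    using p by (auto simp: graph2_def case_prod_beta)
  have g: "z \<in> graph f" "w \<in> graph f"
    using graph_limit[OF f _ z] graph_limit[OF f _ w] pg by auto
  have "time_of (fst (p n)) \<le> time_of (snd (p n))" for n
    using pg(3)[of n] by (cases "fst (p n)"; cases "snd (p n)") (auto simp: graph_le_def)
  then have le: "time_of z \<le> time_of w"
    using tendsto_time_of[OF z] tendsto_time_of[OF w] by (intro LIMSEQ_le) auto
  have "graph_le f z w"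
  proof (cases "time_of z < time_of w")
    case True
    then show ?thesis by (simp add: graph_le_def)
  next
    case False
    with le have eq: "time_of z = time_of w" by simp
    show ?thesis
    proof (cases z)
      case (Pt x t)
      with eq obtain y where wy: "w = Pt y t" by (cases w) auto
      obtain x' t' where ex: "\<forall>\<^sub>F n in sequentially. fst (p n) = Pt (x' n) (t' n)"
        and limx: "x' \<longlonglongrightarrow> x" "t' \<longlonglongrightarrow> t"
        using z unfolding Pt by (rule tendsto_Pt_obtain)
      obtain y' u' where ey: "\<forall>\<^sub>F n in sequentially. snd (p n) = Pt (y' n) (u' n)"
        and limy: "y' \<longlonglongrightarrow> y" "u' \<longlonglongrightarrow> t"
        using w unfolding wy by (rule tendsto_Pt_obtain)
      let ?a = "path_val f (Minus t)" and ?b = "path_val f (Plus t)"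
      have st: "start_time f \<le> ereal t" and xb: "in_between ?a ?b x" and yb: "in_between ?a ?b y"
        using g Pt wy Pt_graph_iff[OF f] by auto
      have n_facts: "\<forall>\<^sub>F n in sequentially. start_time f \<le> ereal (t' n) \<and> start_time f \<le> ereal (u' n) \<and>
          in_between (path_val f (Minus (t' n))) (path_val f (Plus (t' n))) (x' n) \<and>
          in_between (path_val f (Minus (u' n))) (path_val f (Plus (u' n))) (y' n) \<and>
          (t' n < u' n \<or> t' n = u' n \<and> in_between (path_val f (Minus (t' n))) (y' n) (x' n))"
        using ex ey
      proof eventually_elim
        case (elim n)
        have "(Pt (x' n) (t' n), Pt (y' n) (u' n)) \<in> graph2 f"
          using p elim by (metis prod.collapse)
        then show ?case by (simp add: Pt_graph2_iff[OF f] Pt_graph_iff[OF f])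
      qed
      have "in_between ?a y x"
      proof (rule ccontr)
        assume no: "\<not> in_between ?a y x"
        consider "y < x" "?a \<le> y" "x \<le> ?b" | "x < y" "y \<le> ?a" "?b \<le> x"
          using no xb yb by (auto simp: in_between_def min_def max_def split: if_splits)
        then show False
        proof cases
          \<comment> \<open>Near t the path is below m before t and above m after t. So x' n > m
            forces t' n \<ge> t, and y' n < m forces u' n \<le> t. As t' n \<le> u' n, both times
            equal t, where the order of the pair is violated.\<close>
          case 1
          then obtain m where m: "y < m" "m < x" using dense by blast
          have ev: "\<forall>\<^sub>F r in nhds t. (r < t \<longrightarrow> start_time f \<le> ereal r \<longrightarrow> path_val f (Minus r) < m \<and> path_val f (Plus r) < m)
            \<and> (r > t \<longrightarrow> m < path_val f (Minus r) \<and> m < path_val f (Plus r))"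
            using eventually_near_less(1)[OF f, where m=m and t=t] eventually_near_greater(2)[OF f, where m=m and t=t] m 1 st
            by (auto simp: eventually_conj_iff)
          have "\<forall>\<^sub>F n in sequentially. False"
            using n_facts order_tendstoD(1)[OF limx(1) m(2)] order_tendstoD(2)[OF limy(1) m(1)]
              limx(2)[unfolded filterlim_iff, rule_format, OF ev] limy(2)[unfolded filterlim_iff, rule_format, OF ev]
          proof eventually_elim
            case (elim n)
            have "\<not> t' n < t"
              using elim by (auto simp: in_between_def max_def split: if_splits)
            moreover have "\<not> u' n > t"
              using elim by (auto simp: in_between_def min_def split: if_splits)
            ultimately have "t' n = t" "in_between ?a (y' n) (x' n)" using elim by auto
            then show ?case using elim m 1 by (auto simp: in_between_def max_def split: if_splits)
          qed
          then show False by simp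
        next
          case 2
          then obtain m where m: "x < m" "m < y" using dense by blast
          have ev: "\<forall>\<^sub>F r in nhds t. (r < t \<longrightarrow> start_time f \<le> ereal r \<longrightarrow> m < path_val f (Minus r) \<and> m < path_val f (Plus r))
            \<and> (r > t \<longrightarrow> path_val f (Minus r) < m \<and> path_val f (Plus r) < m)"
            using eventually_near_greater(1)[OF f, where m=m and t=t] eventually_near_less(2)[OF f, where m=m and t=t] m 2 st
            by (auto simp: eventually_conj_iff)
          have "\<forall>\<^sub>F n in sequentially. False"
            using n_facts order_tendstoD(2)[OF limx(1) m(1)] order_tendstoD(1)[OF limy(1) m(2)]
              limx(2)[unfolded filterlim_iff, rule_format, OF ev] limy(2)[unfolded filterlim_iff, rule_format, OF ev]
          proof eventually_elim
            case (elim n)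
            have "\<not> t' n < t"
              using elim by (auto simp: in_between_def min_def split: if_splits)
            moreover have "\<not> u' n > t"
              using elim by (auto simp: in_between_def max_def split: if_splits)
            ultimately have "t' n = t" "in_between ?a (y' n) (x' n)" using elim by auto
            then show ?case using elim m 2 by (auto simp: in_between_def min_def split: if_splits)
          qed
          then show False by simp
        qed
      qed
      then show ?thesis using Pt wy by (simp add: graph_le_def)
    next
      case Pinf
      with eq have "w = Pinf" by (cases w) auto
      with Pinf show ?thesis by (simp add: graph_le_def)
    next
      case Minf
      with eq have "w = Minf" by (cases w) auto
      with Minf show ?thesis by (simp add: graph_le_def)
    qed
  qed
  then show "l \<in> graph2 f" using g l by (simp add: graph2_def)
qed

section \<open>Compact sets of paths\<close>

lemma infdist_le_hausdorff_dist:
  fixes S T :: "'a::metric_space set"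
  assumes "bounded (UNIV :: 'a set)" "S \<noteq> {}" "T \<noteq> {}"
  shows "infdist p S \<le> infdist p T + hausdorff_dist S T"
proof -
  obtain a where a: "a \<in> S" using assms(2) by blast
  obtain e where e: "\<And>y. dist a y \<le> e" using assms(1) unfolding bounded_any_center[of _ a] by auto
  \<comment> \<open>Boundedness makes the real supremum in \<open>hausdorff_dist\<close> a genuine
    upper bound.\<close>
  have bdd: "bdd_above ((\<lambda>b. infdist b S) ` T)"
    using infdist_le[OF a] e by (intro bdd_aboveI2[of _ _ e]) (metis dist_commute order_trans)
  have "infdist p S - hausdorff_dist S T \<le> infdist p T"
    unfolding infdist_notempty[OF assms(3)]
  proof (rule cINF_greatest[OF assms(3)])
    fix b assume b: "b \<in> T"
    have "infdist p S \<le> infdist b S + dist p b" by (rule infdist_triangle)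
    also have "infdist b S \<le> hausdorff_dist S T"
      using cSUP_upper[OF b bdd] by (simp add: hausdorff_dist_def)
    finally show "infdist p S - hausdorff_dist S T \<le> dist p b" by simp
  qed
  then show ?thesis by simp
qed

lemma bounded_spacetime2: "bounded (UNIV :: (spacetime \<times> spacetime) set)"
  using bounded_Times[OF compact_imp_bounded[OF compact_spacetime] compact_imp_bounded[OF compact_spacetime]]
  by simp

lemma open_infdist_graph2: "open {f. e < infdist p (graph2 f)}"
  unfolding open_path_def dist_path_def
proof (intro ballI exI conjI allI impI)
  fix f g :: path assume f: "f \<in> {f. e < infdist p (graph2 f)}"
    and "hausdorff_dist (graph2 f) (graph2 g) < infdist p (graph2 f) - e"
  then show "g \<in> {f. e < infdist p (graph2 f)}"
    using infdist_le_hausdorff_dist[OF bounded_spacetime2 graph2_nonempty graph2_nonempty, of p f g]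
    by simp
qed simp

text \<open>Finite-intersection form of compactness. If no member contains P, each member has
  positive distance from some point of P, because \<open>graph2\<close> is closed. These conditions
  are open, and a finite subcover leaves finitely many points with a common radius, against the
  approximation hypothesis. P may be uncountable, as it is for unions of chains in Zorn's
  lemma.\<close>

lemma compact_paths_graph2:
  assumes A: "compact A" "A \<subseteq> paths_up"
    and P: "\<And>F e. finite F \<Longrightarrow> F \<subseteq> P \<Longrightarrow> e > 0 \<Longrightarrow> \<exists>f\<in>A. \<forall>p\<in>F. infdist p (graph2 f) < e"
  shows "\<exists>f\<in>A. P \<subseteq> graph2 f"
proof (rule ccontr)
  assume no: "\<not> (\<exists>f\<in>A. P \<subseteq> graph2 f)"
  define U where "U = (\<lambda>(p, e). {f. e < infdist p (graph2 f)})"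
  have cover: "A \<subseteq> (\<Union>pe\<in>P \<times> {0::real<..}. U pe)"
  proof
    fix f assume f: "f \<in> A"
    then obtain p where p: "p \<in> P" "p \<notin> graph2 f" using no by blast
    have "infdist p (graph2 f) \<noteq> 0"
      using in_closed_iff_infdist_zero[OF closed_graph2 graph2_nonempty] A(2) f p(2) by blast
    then have "infdist p (graph2 f) > 0" using infdist_nonneg[of p "graph2 f"] by linarith
    then show "f \<in> (\<Union>pe\<in>P \<times> {0::real<..}. U pe)"
      using p by (intro UN_I[of "(p, infdist p (graph2 f) / 2)"]) (auto simp: U_def)
  qed
  obtain D where D: "D \<subseteq> P \<times> {0::real<..}" "finite D" "A \<subseteq> (\<Union>pe\<in>D. U pe)"
    by (rule compactE_image[OF A(1) _ cover]) (auto simp: U_def open_infdist_graph2)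
  \<comment> \<open>The inserted 1 keeps the minimum defined for an empty D.\<close>
  define e where "e = Min (insert 1 (snd ` D))"
  have e: "e > 0" using D(1,2) by (auto simp: e_def)
  obtain f where f: "f \<in> A" "\<forall>p\<in>fst ` D. infdist p (graph2 f) < e"
    using P[of "fst ` D" e] D(1,2) e by force
  then obtain p d where pd: "(p, d) \<in> D" "d < infdist p (graph2 f)" using D(3) by (force simp: U_def)
  have "e \<le> d" unfolding e_def using D(2) pd(1) by (intro Min_le) force+
  moreover have "infdist p (graph2 f) < e" using f(2) pd(1) by force
  ultimately show False using pd(2) by linarith
qed

lemma compact_paths_limit:
  assumes A: "compact A" "A \<subseteq> paths_up"
    and p: "\<And>n::nat. \<exists>f\<in>A. p n \<in> graph2 f" "p \<longlonglongrightarrow> l"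
  shows "\<exists>f\<in>A. l \<in> graph2 f"
proof -
  have "\<exists>f\<in>A. {l} \<subseteq> graph2 f"
  proof (rule compact_paths_graph2[OF A])
    fix F and e :: real assume F: "F \<subseteq> {l}" "e > 0"
    obtain n where n: "dist (p n) l < e"
      using metric_LIMSEQ_D[OF p(2) F(2)] by blast
    obtain f where f: "f \<in> A" "p n \<in> graph2 f" using p(1) by blast
    then have "infdist l (graph2 f) < e"
      using infdist_le[OF f(2), of l] n by (simp add: dist_commute)
    then show "\<exists>f\<in>A. \<forall>p\<in>F. infdist p (graph2 f) < e" using f(1) F(1) by blast
  qed
  then show ?thesis by simp
qed

section \<open>Extension and order through lower and upper values\<close>

lemma extended_byD:
  assumes f: "f \<in> paths_up" and g: "g \<in> paths_up" and fg: "extended_by f g"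
  shows "start_time g \<le> start_time f"
    and "active f s \<Longrightarrow> path_val f s = path_val g s"
    and "start_time f = ereal t \<Longrightarrow> in_between (path_val g (Minus t)) (path_val f (Plus t)) (path_val f (Minus t))"
proof -
  have pair: "(Pt (path_val f (Minus t)) t, Pt (path_val f (Plus t)) t) \<in> graph2 g" if "start_time f \<le> ereal t" for t
    using that fg f by (auto simp: extended_by_def Pt_graph2_iff Pt_graph_iff in_between_def)
  show st: "start_time g \<le> start_time f"
  proof (cases "start_time f")
    case (real t)
    then show ?thesis using pair[of t] by (simp add: Pt_graph2_iff[OF g] Pt_graph_iff[OF g])
  next
    case MInf
    then have "(Minf, Minf) \<in> graph2 f" by (simp add: graph2_def graph_def graph_le_def)
    then have "(Minf, Minf) \<in> graph2 g" using fg by (auto simp: extended_by_def)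
    then show ?thesis by (simp add: graph2_def graph_def)
  qed simp
  show act: "path_val f s = path_val g s" if s: "active f s" for s
  proof -
    have sg: "active g s" using s st by (auto simp: active_def)
    \<comment> \<open>f(r+) lies on the graph of g at time r, so it is squeezed between two
      functions of r that both tend to g(s).\<close>
    have ev: "\<forall>\<^sub>F r in side s. min (path_val g (Minus r)) (path_val g (Plus r)) \<le> path_val f (Plus r) \<and>
        path_val f (Plus r) \<le> max (path_val g (Minus r)) (path_val g (Plus r))"
      using eventually_side_active[OF s]
    proof eventually_elim
      case (elim r)
      then show ?case using pair[of r] by (simp add: Pt_graph2_iff[OF g] Pt_graph_iff[OF g] in_between_def)
    qed
    have "((\<lambda>r. min (path_val g (Minus r)) (path_val g (Plus r))) \<longlongrightarrow> min (path_val g s) (path_val g s)) (side s)"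
         "((\<lambda>r. max (path_val g (Minus r)) (path_val g (Plus r))) \<longlongrightarrow> max (path_val g s) (path_val g s)) (side s)"
      by (intro tendsto_min tendsto_max active_tendsto[OF g sg])+
    then have lim: "((\<lambda>r. min (path_val g (Minus r)) (path_val g (Plus r))) \<longlongrightarrow> path_val g s) (side s)"
         "((\<lambda>r. max (path_val g (Minus r)) (path_val g (Plus r))) \<longlongrightarrow> path_val g s) (side s)"
      by simp_all
    have "((\<lambda>r. path_val f (Plus r)) \<longlongrightarrow> path_val g s) (side s)"
      using ev unfolding eventually_conj_iff
      by (intro tendsto_sandwich[OF _ _ lim]) simp_all
    then show ?thesis using active_tendsto(1)[OF f s] tendsto_unique[OF side_nontrivial] by blast
  qed
  show "in_between (path_val g (Minus t)) (path_val f (Plus t)) (path_val f (Minus t))" if "start_time f = ereal t" for t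
    using pair[of t] that by (simp add: Pt_graph2_iff[OF g])
qed

lemma extended_byI:
  assumes f: "f \<in> paths_up" and g: "g \<in> paths_up"
    and st: "start_time g \<le> start_time f"
    and act: "\<And>s. active f s \<Longrightarrow> path_val f s = path_val g s"
    and ini: "\<And>t. start_time f = ereal t \<Longrightarrow> in_between (path_val g (Minus t)) (path_val f (Plus t)) (path_val f (Minus t))"
  shows "extended_by f g"
proof -
  have bet: "in_between (path_val g (Minus t)) (path_val g (Plus t)) x"
    if "start_time f \<le> ereal t" "in_between (path_val f (Minus t)) (path_val f (Plus t)) x" for x t
    using that ini[of t] act[of "Plus t"] act[of "Minus t"] unfolding in_between_def
    by (cases "start_time f = ereal t") (auto simp: min_def max_def split: if_splits)
  have gr: "z \<in> graph g" if z: "z \<in> graph f" for z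
  proof (cases z)
    case (Pt x t)
    then show ?thesis using z bet by (auto simp: Pt_graph_iff f g intro: order_trans[OF st])
  next
    case Pinf
    then show ?thesis using g by (simp add: graph_def paths_up_def)
  next
    case Minf
    then show ?thesis using z st by (auto simp: graph_def)
  qed
  have ord: "graph_le g z w" if zw: "z \<in> graph f" "w \<in> graph f" "graph_le f z w" for z w
  proof (cases "time_of z < time_of w")
    case True
    then show ?thesis by (simp add: graph_le_def)
  next
    case False
    show ?thesis
    proof (cases z)
      case (Pt x t)
      with zw False obtain y where y: "w = Pt y t" by (cases w) (auto simp: graph_le_def)
      have *: "start_time f \<le> ereal t" "in_between (path_val f (Minus t)) (path_val f (Plus t)) x"
        "in_between (path_val f (Minus t)) (path_val f (Plus t)) y" "in_between (path_val f (Minus t)) y x"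
        using zw Pt y by (simp_all add: Pt_graph_iff[OF f] graph_le_def)
      have "in_between (path_val g (Minus t)) y x"
      proof (cases "start_time f = ereal t")
        case True
        then show ?thesis using * ini[of t]
          by (auto simp: in_between_def min_def max_def split: if_splits)
      next
        case False
        then show ?thesis using * act[of "Minus t"] by simp
      qed
      then show ?thesis using Pt y by (simp add: graph_le_def)
    qed (use zw False in \<open>cases w; auto simp: graph_le_def\<close>)+
  qed
  show ?thesis using gr ord by (auto simp: extended_by_def graph2_def)
qed

lemma not_active_startE:
  assumes "start_time f \<le> ereal (base s)" "\<not> active f s"
  obtains t where "s = Minus t" "start_time f = ereal t"
  using assms by (cases s) auto

lemma activity_cases:
  obtains "active f s" | t where "s = Minus t" "start_time f = ereal t" | "ereal (base s) < start_time f"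
  by (cases s; cases "start_time f" "ereal (base s)" rule: linorder_cases) auto

lemma extended_by_iff:
  assumes f: "f \<in> paths_up" and g: "g \<in> paths_up"
  shows "extended_by f g \<longleftrightarrow> (\<forall>s. lower_val f s \<le> lower_val g s \<and> upper_val g s \<le> upper_val f s)"
proof (intro iffI allI)
  fix s assume e: "extended_by f g"
  note E = extended_byD[OF f g e]
  show "lower_val f s \<le> lower_val g s \<and> upper_val g s \<le> upper_val f s"
  proof (cases rule: activity_cases[of f s])
    case 1
    then have "active g s" using E(1) by (auto simp: active_def)
    with 1 E(2) show ?thesis by simp
  next
    case (2 t)
    have c: "path_val f (Plus t) = path_val g (Plus t)" using E(2)[of "Plus t"] 2 by simp
    have "in_between (path_val g (Minus t)) (path_val f (Plus t)) (path_val f (Minus t))"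
      using E(3)[OF 2(2)] .
    moreover have "active g (Minus t) \<or> start_time g = ereal t" using E(1) 2 by (auto simp: less_le)
    ultimately show ?thesis using c 2
      by (auto simp: start_vals in_between_def min_def max_def split: if_splits)
  next
    case 3
    then show ?thesis by (simp add: before_vals)
  qed
next
  assume *: "\<forall>s. lower_val f s \<le> lower_val g s \<and> upper_val g s \<le> upper_val f s"
  \<comment> \<open>At an active split time the bounds of f coincide, so those of g are pinched to
    the same value.\<close>
  have act: "start_time g \<le> ereal (base s)" "path_val f s = path_val g s" if "active f s" for s
  proof -
    have "lower_val g s = upper_val g s" "lower_val g s = path_val f s"
      using *[rule_format, of s] that lower_le_upper[of g s] by auto
    then show "start_time g \<le> ereal (base s)" "path_val f s = path_val g s" using eq_valsD[of g s] by auto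
  qed
  show "extended_by f g"
  proof (rule extended_byI[OF f g])
    show "start_time g \<le> start_time f"
    proof (rule ccontr)
      assume "\<not> start_time g \<le> start_time f"
      then obtain r where "start_time f < ereal r" "ereal r < start_time g"
        using ereal_dense2[of "start_time f" "start_time g"] by (auto simp: not_le)
      then show False using act(1)[of "Minus r"] by simp
    qed
    fix t assume t: "start_time f = ereal t"
    have c: "path_val f (Plus t) = path_val g (Plus t)" using act(2)[of "Plus t"] t by simp
    have l: "lower_val f (Minus t) \<le> lower_val g (Minus t)" and u: "upper_val g (Minus t) \<le> upper_val f (Minus t)"
      using * by auto
    consider "path_val f (Minus t) = path_val f (Plus t)" | "path_val f (Plus t) < path_val f (Minus t)"
      | "path_val f (Minus t) < path_val f (Plus t)" by fastforce
    then show "in_between (path_val g (Minus t)) (path_val f (Plus t)) (path_val f (Minus t))"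
    proof cases
      case 1
      then show ?thesis by (simp add: in_between_def)
    next
      case 2
      then have "path_val f (Minus t) \<le> lower_val g (Minus t)" using l by (simp add: start_vals(1)[OF t])
      moreover from this have "lower_val g (Minus t) = path_val g (Minus t)"
        using 2 by (intro lower_val_notD(1)) auto
      ultimately show ?thesis using 2 by (simp add: in_between_def)
    next
      case 3
      then have "upper_val g (Minus t) \<le> path_val f (Minus t)" using u by (simp add: start_vals(2)[OF t])
      moreover from this have "upper_val g (Minus t) = path_val g (Minus t)"
        using 3 by (intro upper_val_notD(1)) auto
      ultimately show ?thesis using 3 by (simp add: in_between_def)
    qed
  qed (use act(2) in blast)
qed

section \<open>Bi-infinite extensions and the order\<close>

lemma cadlag_UNIV_iff:
  "cadlag (-\<infinity>) \<infinity> v \<longleftrightarrow>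
    (\<forall>s. ((\<lambda>r. v (Plus r)) \<longlongrightarrow> v s) (side s) \<and> ((\<lambda>r. v (Minus r)) \<longlongrightarrow> v s) (side s))"
proof
  assume v: "cadlag (-\<infinity>) \<infinity> v"
  show "\<forall>s. ((\<lambda>r. v (Plus r)) \<longlongrightarrow> v s) (side s) \<and> ((\<lambda>r. v (Minus r)) \<longlongrightarrow> v s) (side s)"
  proof
    fix s show "((\<lambda>r. v (Plus r)) \<longlongrightarrow> v s) (side s) \<and> ((\<lambda>r. v (Minus r)) \<longlongrightarrow> v s) (side s)"
      using v by (cases s) (auto simp: cadlag_def)
  qed
next
  assume *: "\<forall>s. ((\<lambda>r. v (Plus r)) \<longlongrightarrow> v s) (side s) \<and> ((\<lambda>r. v (Minus r)) \<longlongrightarrow> v s) (side s)"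
  show "cadlag (-\<infinity>) \<infinity> v"
    unfolding cadlag_def
  proof (intro conjI allI impI)
    fix t
    show "((\<lambda>s. v (Plus s)) \<longlongrightarrow> v (Plus t)) (at_right t)" "((\<lambda>s. v (Minus s)) \<longlongrightarrow> v (Plus t)) (at_right t)"
      "((\<lambda>s. v (Plus s)) \<longlongrightarrow> v (Minus t)) (at_left t)" "((\<lambda>s. v (Minus s)) \<longlongrightarrow> v (Minus t)) (at_left t)"
      using *[rule_format, of "Plus t"] *[rule_format, of "Minus t"] by simp_all
  qed
qed

text \<open>\<open>lower_val\<close> and \<open>upper_val\<close> need not be cadlag: they can be
  finite at the initial t- and are infinite just before. Freezing the chosen bound \<open>w\<close>
  at t- for all earlier times repairs this and stays between the two bounds.\<close>

definition extend_back :: "path \<Rightarrow> (path \<Rightarrow> real split_time \<Rightarrow> ereal) \<Rightarrow> real split_time \<Rightarrow> ereal" where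
  "extend_back f w s = w f (case start_time f of ereal q \<Rightarrow> max (Minus q) s | _ \<Rightarrow> s)"

lemma extend_back_eq:
  assumes "start_time f \<le> ereal (base s)"
  shows "extend_back f w s = w f s"
  using assms by (cases "start_time f"; cases s) (auto simp: extend_back_def max_def less_eq_split_time_def)

lemma cadlag_extend_back:
  assumes f: "f \<in> paths_up" and w: "\<And>s. active f s \<Longrightarrow> w f s = path_val f s"
    and inf: "start_time f = \<infinity> \<Longrightarrow> w f = (\<lambda>_. c)"
  shows "cadlag (-\<infinity>) \<infinity> (extend_back f w)"
  unfolding cadlag_UNIV_iff
proof
  fix s
  show "((\<lambda>r. extend_back f w (Plus r)) \<longlongrightarrow> extend_back f w s) (side s) \<and>
      ((\<lambda>r. extend_back f w (Minus r)) \<longlongrightarrow> extend_back f w s) (side s)"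
  proof (cases "active f s")
    case True
    have eq: "extend_back f w s' = path_val f s'" if "active f s'" for s'
    proof -
      have "start_time f \<le> ereal (base s')" using that by (auto simp: active_def)
      then show ?thesis using that w by (simp add: extend_back_eq)
    qed
    have ev: "\<forall>\<^sub>F r in side s. path_val f (Minus r) = extend_back f w (Minus r)"
      "\<forall>\<^sub>F r in side s. path_val f (Plus r) = extend_back f w (Plus r)"
      using eventually_side_active[OF True] by (auto elim!: eventually_mono simp: eq)
    show ?thesis
      using Lim_transform_eventually[OF active_tendsto(1)[OF f True] ev(2)]
        Lim_transform_eventually[OF active_tendsto(2)[OF f True] ev(1)] eq[OF True] by simp
  next
    case False
    have "\<forall>\<^sub>F r in side s. extend_back f w (Plus r) = extend_back f w s \<and> extend_back f w (Minus r) = extend_back f w s"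
    proof (cases "start_time f")
      case (real q)
      have "\<forall>\<^sub>F r in side s. r < q"
      proof (cases s)
        case (Minus t)
        then have "t \<le> q" using False real by auto
        moreover have "\<forall>\<^sub>F r in at_left t. r < t" by (simp add: eventually_at_filter)
        ultimately show ?thesis using Minus by (auto elim: eventually_mono)
      next
        case (Plus t)
        then have "t < q" using False real by auto
        then show ?thesis using Plus by (auto simp: eventually_at_right[of t q])
      qed
      moreover have "max (Minus q) s = Minus q"
        using False real by (cases s) (auto simp: max_def less_eq_split_time_def)
      ultimately show ?thesis using real
        by (auto elim!: eventually_mono simp: extend_back_def max_def less_eq_split_time_def)
    next
      case PInf
      then show ?thesis by (simp add: extend_back_def inf)
    next
      case MInf
      then show ?thesis using False by (simp add: active_def)
    qed
    then show ?thesis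
      by (intro conjI tendsto_eventually) (auto elim: eventually_mono)
  qed
qed

lemma start_infty_vals:
  assumes "start_time f = \<infinity>"
  shows "lower_val f = (\<lambda>_. -\<infinity>)" "upper_val f = (\<lambda>_. \<infinity>)"
  using assms by (auto simp: before_vals)

lemma updown_vals:
  assumes "f \<in> paths_updown"
  shows "lower_val f = path_val f" "upper_val f = path_val f" "f \<in> paths_up" "active f s"
  using assms by (auto simp: paths_updown_def paths_down_def active_def)

lemma extend_back_vals:
  assumes "w = lower_val \<or> w = upper_val"
  shows "lower_val f s \<le> extend_back f w s \<and> extend_back f w s \<le> upper_val f s"
proof (cases "start_time f \<le> ereal (base s)")
  case True
  then show ?thesis using assms lower_le_upper[of f s] by (auto simp: extend_back_eq)
next
  case False
  then show ?thesis by (simp add: before_vals)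
qed

lemma extended_by_biinfinite:
  assumes f: "f \<in> paths_up" and v: "cadlag (-\<infinity>) \<infinity> v"
    and le: "\<And>s. lower_val f s \<le> v s \<and> v s \<le> upper_val f s"
  shows "extended_by f (biinfinite_path v)"
  using biinfinite_path[OF v] le by (simp add: extended_by_iff f updown_vals)

lemma below_iff:
  assumes f: "f \<in> paths_up" and g: "g \<in> paths_up"
  shows "below f g \<longleftrightarrow> (\<forall>s. lower_val f s \<le> upper_val g s)"
proof
  assume "below f g"
  then obtain f' g' where *: "f' \<in> paths_updown" "g' \<in> paths_updown" "extended_by f f'" "extended_by g g'"
      "\<forall>s. path_val f' s \<le> path_val g' s"
    by (auto simp: below_def)
  show "\<forall>s. lower_val f s \<le> upper_val g s"
  proof
    fix s
    have "lower_val f s \<le> path_val f' s" "path_val g' s \<le> upper_val g s"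
      using * f g by (simp_all add: extended_by_iff updown_vals)
    then show "lower_val f s \<le> upper_val g s" using *(5) by (meson order_trans)
  qed
next
  assume le: "\<forall>s. lower_val f s \<le> upper_val g s"
  have belowI: "below f g" if "cadlag (-\<infinity>) \<infinity> v" "cadlag (-\<infinity>) \<infinity> w" "\<And>s. v s \<le> w s"
    "\<And>s. lower_val f s \<le> v s \<and> v s \<le> upper_val f s" "\<And>s. lower_val g s \<le> w s \<and> w s \<le> upper_val g s" for v w
    unfolding below_def using that biinfinite_path
    by (intro bexI[of _ "biinfinite_path v"] bexI[of _ "biinfinite_path w"] conjI extended_by_biinfinite f g) auto
  let ?v = "extend_back f lower_val" and ?w = "extend_back g upper_val"
  have v: "cadlag (-\<infinity>) \<infinity> ?v" using cadlag_extend_back[OF f, of lower_val] start_infty_vals by auto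
  have w: "cadlag (-\<infinity>) \<infinity> ?w" using cadlag_extend_back[OF g, of upper_val] start_infty_vals by auto
  \<comment> \<open>Before the later start the two continuations may be in the wrong order. The
    maximum or minimum corrects the path that starts later: wherever its relevant bound is
    nontrivial, the other path has started too, so the hypothesis applies there.\<close>
  consider "start_time f \<le> start_time g" | "start_time g \<le> start_time f" by fastforce
  then show "below f g"
  proof cases
    case 1
    have "cadlag (-\<infinity>) \<infinity> (\<lambda>s. max (?w s) (?v s))"
      using v w by (auto simp: cadlag_UNIV_iff intro: tendsto_max)
    moreover have "?v s \<le> upper_val g s" for s
    proof (cases "start_time f \<le> ereal (base s)")
      case True
      then show ?thesis using le by (simp add: extend_back_eq)
    next
      case False
      then show ?thesis using 1 by (simp add: before_vals)
    qed
    ultimately show ?thesis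
      using extend_back_vals by (intro belowI[OF v]) (auto simp: le_max_iff_disj)
  next
    case 2
    have "cadlag (-\<infinity>) \<infinity> (\<lambda>s. min (?w s) (?v s))"
      using v w by (auto simp: cadlag_UNIV_iff intro: tendsto_min)
    moreover have "lower_val f s \<le> ?w s" for s
    proof (cases "start_time g \<le> ereal (base s)")
      case True
      then show ?thesis using le by (simp add: extend_back_eq)
    next
      case False
      then show ?thesis using 2 by (simp add: before_vals)
    qed
    ultimately show ?thesis
      using extend_back_vals by (intro belowI[OF _ w]) (auto simp: min_le_iff_disj)
  qed
qed

lemma crosses_iff: "crosses f g \<longleftrightarrow> \<not> below f g \<and> \<not> below g f"
  unfolding crosses_def below_def by blast

lemma extended_by_antisym:
  assumes f: "f \<in> paths_up" and g: "g \<in> paths_up" and "extended_by f g" "extended_by g f"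
  shows "f = g"
proof (rule path_eqI)
  note E = extended_byD[OF f g assms(3)] extended_byD[OF g f assms(4)]
  show st: "start_time f = start_time g" using E(1,4) by simp
  show "end_time f = end_time g" using f g by (simp add: paths_up_def)
  fix s assume "start_time f \<le> ereal (base s)"
  then show "path_val f s = path_val g s"
  proof (cases rule: activity_cases[of f s])
    case 1
    then show ?thesis using E(2) by simp
  next
    case (2 t)
    then have "path_val f (Plus t) = path_val g (Plus t)" using E(2)[of "Plus t"] by simp
    then show ?thesis using E(3)[of t] E(6)[of t] 2 st
      by (auto simp: in_between_def min_def max_def split: if_splits)
  qed auto
qed

lemma extended_by_imp_below:
  assumes "f \<in> paths_up" "g \<in> paths_up" "extended_by f g"
  shows "below f g" "below g f"
proof -
  have "lower_val f s \<le> upper_val g s" "lower_val g s \<le> upper_val f s" for s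
    using assms lower_le_upper[of f s] lower_le_upper[of g s]
    by (auto simp: extended_by_iff intro: order_trans)
  then show "below f g" "below g f" using assms by (simp_all add: below_iff)
qed

lemma below_refl: "f \<in> paths_up \<Longrightarrow> below f f"
  by (simp add: below_iff lower_le_upper)

lemma below_antisym_aux:
  assumes f: "f \<in> paths_up" and g: "g \<in> paths_up" and fg: "below f g" and gf: "below g f"
    and st: "start_time g \<le> start_time f"
  shows "extended_by f g \<or> extended_by g f"
proof -
  have le: "lower_val f s \<le> upper_val g s" "lower_val g s \<le> upper_val f s" for s
    using fg gf f g by (auto simp: below_iff)
  \<comment> \<open>Where g is active its bounds coincide, and the two inequalities place this value
    between the bounds of f. What remains is t- for a common start time t.\<close>
  have ge: "lower_val f s \<le> lower_val g s \<and> upper_val g s \<le> upper_val f s" if "active g s" for s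
    using le[of s] that by simp
  show ?thesis
  proof (cases "\<exists>t. start_time f = ereal t \<and> start_time g = ereal t")
    case False
    have "lower_val f s \<le> lower_val g s \<and> upper_val g s \<le> upper_val f s" for s
    proof (cases "active g s")
      case False
      have "ereal (base s) < start_time f"
      proof (rule ccontr)
        assume "\<not> ereal (base s) < start_time f"
        then have "start_time f \<le> ereal (base s)" by simp
        then obtain t where "s = Minus t" "start_time g = ereal t"
          using not_active_startE[of g s] False st order_trans by blast
        then have "start_time f = ereal t" using \<open>start_time f \<le> ereal (base s)\<close> st by simp
        then show False using \<open>\<nexists>t. start_time f = ereal t \<and> start_time g = ereal t\<close> \<open>start_time g = ereal t\<close> by blast
      qed
      then show ?thesis by (simp add: before_vals)
    qed (rule ge)
    then show ?thesis using f g by (simp add: extended_by_iff)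
  next
    case True
    then obtain t where t: "start_time f = ereal t" "start_time g = ereal t" by blast
    have act: "active f s \<longleftrightarrow> active g s" for s using t by (simp add: active_def)
    have eq: "lower_val f s = lower_val g s \<and> upper_val f s = upper_val g s" if "s \<noteq> Minus t" for s
    proof (cases "active g s")
      case True
      then show ?thesis using le[of s] act[of s] by auto
    next
      case False
      then have "ereal (base s) < start_time f" "ereal (base s) < start_time g"
        using t that activity_cases[of f s] act[of s] by auto
      then show ?thesis by (simp add: before_vals)
    qed
    have c: "path_val f (Plus t) = path_val g (Plus t)"
      using le[of "Plus t"] t by auto
    \<comment> \<open>The values at t+ agree, so initial jumps in opposite directions would violate
      \<open>le\<close>. The constraints at t- are therefore trivial or half-lines pointing the same
      way, hence nested.\<close>
    have m: "(lower_val f (Minus t) \<le> lower_val g (Minus t) \<and> upper_val g (Minus t) \<le> upper_val f (Minus t)) \<or>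
        (lower_val g (Minus t) \<le> lower_val f (Minus t) \<and> upper_val f (Minus t) \<le> upper_val g (Minus t))"
      using le[of "Minus t"] c unfolding start_vals[OF t(1)] start_vals[OF t(2)]
      by (auto split: if_splits)
    from m show ?thesis
    proof
      assume *: "lower_val f (Minus t) \<le> lower_val g (Minus t) \<and> upper_val g (Minus t) \<le> upper_val f (Minus t)"
      have "lower_val f s \<le> lower_val g s \<and> upper_val g s \<le> upper_val f s" for s
        using * eq[of s] by (cases "s = Minus t") auto
      then show ?thesis by (simp add: extended_by_iff f g)
    next
      assume *: "lower_val g (Minus t) \<le> lower_val f (Minus t) \<and> upper_val f (Minus t) \<le> upper_val g (Minus t)"
      have "lower_val g s \<le> lower_val f s \<and> upper_val f s \<le> upper_val g s" for s
        using * eq[of s] by (cases "s = Minus t") auto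
      then show ?thesis by (simp add: extended_by_iff f g)
    qed
  qed
qed

lemma below_antisym:
  assumes "f \<in> paths_up" "g \<in> paths_up" "below f g" "below g f"
  shows "extended_by f g \<or> extended_by g f"
  using below_antisym_aux[OF assms] below_antisym_aux[OF assms(2,1,4,3)] linear by blast

text \<open>\<open>below\<close> is not transitive: a path with start time \<infinity> is below and
  above every path. This is the substitute. If the two conclusions fail at s and s', then
  \<open>g\<close> is inactive at s and \<open>f\<close> at s', while \<open>f\<close> has started
  at s and \<open>g\<close> at s'. This forces a common start time t and s = s' = t-, where the
  inequalities close up to a strict cycle.\<close>

lemma below_cycle:
  assumes p: "f \<in> paths_up" "g \<in> paths_up" "h \<in> paths_up"
    and b: "below f g" "below g h" "below h f"
  shows "below f h \<or> below h g"
proof (rule ccontr)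
  assume "\<not> ?thesis"
  then have "\<not> (\<forall>s. lower_val f s \<le> upper_val h s)" "\<not> (\<forall>s. lower_val h s \<le> upper_val g s)"
    using below_iff[OF p(1,3)] below_iff[OF p(3,2)] by blast+
  then obtain s s' where s: "upper_val h s < lower_val f s" and s': "upper_val g s' < lower_val h s'"
    unfolding not_all not_le by blast
  have le: "lower_val f u \<le> upper_val g u" "lower_val g u \<le> upper_val h u" "lower_val h u \<le> upper_val f u" for u
    using b below_iff[OF p(1,2)] below_iff[OF p(2,3)] below_iff[OF p(3,1)] by blast+
  have g_inactive: "\<not> active g s"
    using s le[of s] by (metis active_vals leD order_trans)
  have f_inactive: "\<not> active f s'"
    using s' le[of s'] by (metis active_vals leD order_trans)
  have "lower_val f s \<noteq> -\<infinity>" "upper_val g s' \<noteq> \<infinity>" using s s' by auto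
  then have "start_time f \<le> ereal (base s)" "start_time g \<le> ereal (base s')"
    by (blast dest: lower_val_notD upper_val_notD)+
  moreover have "ereal (base s) \<le> start_time g" "ereal (base s') \<le> start_time f"
    using g_inactive f_inactive by (auto simp: active_def)
  ultimately have "base s = base s'" "start_time f = ereal (base s)" "start_time g = ereal (base s)"
    by (metis antisym ereal_less_eq(3) order_trans)+
  then have "s = s'"
    using g_inactive f_inactive by (cases s; cases s') auto
  then have "lower_val f s \<le> upper_val g s" "upper_val g s < lower_val h s" "lower_val h s \<le> upper_val h s"
      "upper_val h s < lower_val f s"
    using s s' le(1)[of s] lower_le_upper[of h s] by blast+
  then show False by (meson leD order_less_le_trans order_trans less_imp_le)
qed

section \<open>Maximal extensions and limits of jumps\<close>

text \<open>Zorn's lemma on the ordered graphs: every finite part of the union of a chain lies in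
  one member, so compactness yields a path whose graph contains the whole union.\<close>

lemma maximal_extension:
  assumes A: "compact A" "A \<subseteq> paths_up" and k: "k \<in> A"
  obtains g where "g \<in> max_paths A" "extended_by k g"
proof -
  let ?G = "graph2 ` {f \<in> A. extended_by k f}"
  have "\<exists>M\<in>?G. \<forall>X\<in>?G. M \<subseteq> X \<longrightarrow> X = M"
  proof (rule subset_Zorn)
    fix C assume C: "subset.chain ?G C"
    show "\<exists>U\<in>?G. \<forall>X\<in>C. X \<subseteq> U"
    proof (cases "C = {}")
      case True
      then show ?thesis using k by (auto simp: extended_by_def)
    next
      case False
      have "\<exists>f\<in>A. \<Union>C \<subseteq> graph2 f"
      proof (rule compact_paths_graph2[OF A])
        fix F and e :: real
        assume F: "finite F" "F \<subseteq> \<Union>C" and e: "e > 0"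
        obtain D where D: "D \<in> C" "F \<subseteq> D"
          using finite_subset_Union_chain[OF F False C] by blast
        then obtain f where f: "f \<in> A" "D = graph2 f" using C by (auto simp: subset.chain_def)
        then show "\<exists>f\<in>A. \<forall>p\<in>F. infdist p (graph2 f) < e"
          using D(2) e by (intro bexI[of _ f]) auto
      qed
      then obtain f where f: "f \<in> A" "\<Union>C \<subseteq> graph2 f" ..
      from False obtain D where "D \<in> C" by (meson ex_in_conv)
      then have "D \<in> ?G" using C by (auto simp: subset.chain_def)
      then have "graph2 k \<subseteq> D" by (auto simp: extended_by_def)
      also have "D \<subseteq> graph2 f" using f(2) \<open>D \<in> C\<close> by blast
      finally have "graph2 f \<in> ?G" using f(1) by (simp add: extended_by_def)
      then show ?thesis using f(2) by blast
    qed
  qed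
  then obtain g where g: "g \<in> A" "extended_by k g"
    and max: "\<And>f. f \<in> A \<Longrightarrow> extended_by k f \<Longrightarrow> graph2 g \<subseteq> graph2 f \<Longrightarrow> graph2 f = graph2 g"
    by blast
  have "f = g" if f: "f \<in> A" "extended_by g f" for f
  proof -
    have "graph2 f = graph2 g" using max[of f] f g(2) by (auto simp: extended_by_def)
    then show "f = g" using A(2) f g(1) by (intro extended_by_antisym) (auto simp: extended_by_def)
  qed
  then show thesis using that g by (auto simp: max_paths_def)
qed

text \<open>A point of the graph at time r bounds the path at r- or at r+, with no control over
  which. An initial jump causes no loss: it makes exactly the bounds nontrivial that are used
  here.\<close>

lemma graph_vals:
  assumes "g \<in> paths_up" "Pt x r \<in> graph g"
  shows "x \<le> lower_val g (Minus r) \<or> x \<le> lower_val g (Plus r)"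
    and "upper_val g (Minus r) \<le> x \<or> upper_val g (Plus r) \<le> x"
proof -
  have *: "start_time g \<le> ereal r" "in_between (path_val g (Minus r)) (path_val g (Plus r)) x"
    using assms by (simp_all add: Pt_graph_iff)
  then have "active g (Minus r) \<or> start_time g = ereal r" by auto
  then show "x \<le> lower_val g (Minus r) \<or> x \<le> lower_val g (Plus r)"
    and "upper_val g (Minus r) \<le> x \<or> upper_val g (Plus r) \<le> x"
    using * by (auto simp: start_vals in_between_def min_def max_def split: if_splits)
qed

lemma graph2_valsI:
  assumes f: "f \<in> paths_up" and s: "start_time f \<le> ereal (base s)" "s \<le> s'"
  shows "(Pt (path_val f s) (base s), Pt (path_val f s') (base s')) \<in> graph2 f"
proof -
  have "base s \<le> base s'" using s(2) by (auto simp: less_eq_split_time_def)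
  then have "start_time f \<le> ereal (base s')" using s(1) by (metis ereal_less_eq(3) order_trans)
  then show ?thesis
    using s by (cases s; cases s')
      (auto simp: Pt_graph2_iff[OF f] Pt_graph_iff[OF f] in_between_def less_eq_split_time_def)
qed

text \<open>A lower value exceeding another one is not -\<infinity>, so the path has started by s;
  the strict drop excludes s = s', so s' is active. Both lower values are then true values of the
  path.\<close>

lemma graph2_downI:
  assumes f: "f \<in> paths_up" and s: "s \<le> s'" "lower_val f s' < lower_val f s"
  shows "(Pt (lower_val f s) (base s), Pt (lower_val f s') (base s')) \<in> graph2 f"
proof -
  have "lower_val f s \<noteq> -\<infinity>" using s(2) by auto
  note v = lower_val_notD[OF this]
  have "active f s'"
    using s v(2) by (cases s; cases s'; cases "start_time f") (auto simp: less_eq_split_time_def)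
  then show ?thesis using graph2_valsI[OF f v(2) s(1)] v(1) by simp
qed

lemma graph2_upI:
  assumes f: "f \<in> paths_up" and s: "s \<le> s'" "upper_val f s < upper_val f s'"
  shows "(Pt (upper_val f s) (base s), Pt (upper_val f s') (base s')) \<in> graph2 f"
proof -
  have "upper_val f s \<noteq> \<infinity>" using s(2) by auto
  note v = upper_val_notD[OF this]
  have "active f s'"
    using s v(2) by (cases s; cases s'; cases "start_time f") (auto simp: less_eq_split_time_def)
  then show ?thesis using graph2_valsI[OF f v(2) s(1)] v(1) by simp
qed

lemma graph2_jumpD:
  assumes f: "f \<in> paths_up" and p: "(Pt x t, Pt y t) \<in> graph2 f"
  shows "y < x \<Longrightarrow> x \<le> lower_val f (Minus t) \<and> upper_val f (Plus t) \<le> y"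
    and "x < y \<Longrightarrow> upper_val f (Minus t) \<le> x \<and> y \<le> lower_val f (Plus t)"
proof -
  have *: "start_time f \<le> ereal t" "in_between (path_val f (Minus t)) (path_val f (Plus t)) x"
    "in_between (path_val f (Minus t)) (path_val f (Plus t)) y" "in_between (path_val f (Minus t)) y x"
    using p by (simp_all add: Pt_graph2_iff[OF f] Pt_graph_iff[OF f])
  then have "active f (Minus t) \<or> start_time f = ereal t" by auto
  then show "y < x \<Longrightarrow> x \<le> lower_val f (Minus t) \<and> upper_val f (Plus t) \<le> y"
    and "x < y \<Longrightarrow> upper_val f (Minus t) \<le> x \<and> y \<le> lower_val f (Plus t)"
    using * by (auto simp: start_vals in_between_def min_def max_def split: if_splits)
qed

section \<open>Limits of steep pieces of paths\<close>

lemma pair_limit: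
  fixes S T :: "ereal set"
  assumes A: "compact A" "A \<subseteq> paths_up" and cl: "closed S" "closed T"
    and *: "\<And>e. e > 0 \<Longrightarrow> \<exists>f\<in>A. \<exists>x\<in>S. \<exists>y\<in>T. \<exists>t1 t2. \<bar>t1 - t\<bar> < e \<and> \<bar>t2 - t\<bar> < e \<and> (Pt x t1, Pt y t2) \<in> graph2 f"
  shows "\<exists>f\<in>A. \<exists>x\<in>S. \<exists>y\<in>T. (Pt x t, Pt y t) \<in> graph2 f"
proof -
  have "\<forall>n. \<exists>f x y t1 t2. f \<in> A \<and> x \<in> S \<and> y \<in> T \<and> \<bar>t1 - t\<bar> < inverse (real (Suc n)) \<and>
      \<bar>t2 - t\<bar> < inverse (real (Suc n)) \<and> (Pt x t1, Pt y t2) \<in> graph2 f"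
  proof
    fix n
    show "\<exists>f x y t1 t2. f \<in> A \<and> x \<in> S \<and> y \<in> T \<and> \<bar>t1 - t\<bar> < inverse (real (Suc n)) \<and>
      \<bar>t2 - t\<bar> < inverse (real (Suc n)) \<and> (Pt x t1, Pt y t2) \<in> graph2 f"
      using *[of "inverse (real (Suc n))"] by fastforce
  qed
  then obtain f x y t1 t2 where fn: "\<And>n. f n \<in> A" "\<And>n. x n \<in> S" "\<And>n. y n \<in> T"
      "\<And>n. \<bar>t1 n - t\<bar> < inverse (real (Suc n))" "\<And>n. \<bar>t2 n - t\<bar> < inverse (real (Suc n))"
      "\<And>n. (Pt (x n) (t1 n), Pt (y n) (t2 n)) \<in> graph2 (f n)"
    by metis
  have "(\<lambda>n. t1 n - t) \<longlonglongrightarrow> 0" "(\<lambda>n. t2 n - t) \<longlonglongrightarrow> 0"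
    using fn(4,5) by (intro Lim_null_comparison[OF _ LIMSEQ_inverse_real_of_nat]; simp add: less_imp_le)+
  then have t: "t1 \<longlonglongrightarrow> t" "t2 \<longlonglongrightarrow> t" by (simp_all add: LIM_zero_iff)
  obtain x0 r where r: "strict_mono r" "(x \<circ> r) \<longlonglongrightarrow> x0" using compact_complete_linorder by blast
  obtain y0 r' where r': "strict_mono r'" "((y \<circ> r) \<circ> r') \<longlonglongrightarrow> y0" using compact_complete_linorder by blast
  define q where "q = r \<circ> r'"
  have q: "strict_mono q" using r(1) r'(1) by (simp add: q_def strict_mono_o)
  have lim: "(\<lambda>n. x (q n)) \<longlonglongrightarrow> x0" "(\<lambda>n. y (q n)) \<longlonglongrightarrow> y0"
    using LIMSEQ_subseq_LIMSEQ[OF r(2) r'(1)] r'(2) by (simp_all add: q_def o_def)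
  have "(\<lambda>n. t1 (q n)) \<longlonglongrightarrow> t" "(\<lambda>n. t2 (q n)) \<longlonglongrightarrow> t"
    using LIMSEQ_subseq_LIMSEQ[OF t(1) q] LIMSEQ_subseq_LIMSEQ[OF t(2) q] by (simp_all add: o_def)
  then have L: "(\<lambda>n. (Pt (x (q n)) (t1 (q n)), Pt (y (q n)) (t2 (q n)))) \<longlonglongrightarrow> (Pt x0 t, Pt y0 t)"
    using lim by (intro tendsto_Pair) (simp_all add: tendsto_Pt_iff)
  have mem: "\<exists>f\<in>A. (Pt (x (q n)) (t1 (q n)), Pt (y (q n)) (t2 (q n))) \<in> graph2 f" for n
    using fn(1)[of "q n"] fn(6)[of "q n"] by blast
  have "\<exists>f\<in>A. (Pt x0 t, Pt y0 t) \<in> graph2 f"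
    by (rule compact_paths_limit[OF A mem L])
  moreover have "x0 \<in> S" "y0 \<in> T"
    using closed_sequentially[OF cl(1) _ lim(1)] closed_sequentially[OF cl(2) _ lim(2)] fn(2,3) by auto
  ultimately show ?thesis by blast
qed

text \<open>Lower values are the right ones for a fall: being \<ge> b > a at the earlier time
  certifies that the path has started. For a climb the upper values do this, as in
  \<open>up_limit\<close>.\<close>

lemma down_limit:
  assumes A: "compact A" "A \<subseteq> paths_up" and ab: "a < b"
    and *: "\<And>e. e > 0 \<Longrightarrow> \<exists>f\<in>A. \<exists>s s'. s \<le> s' \<and> \<bar>base s - t\<bar> < e \<and> \<bar>base s' - t\<bar> < e \<and>
      b \<le> lower_val f s \<and> lower_val f s' \<le> a"
  shows "\<exists>f\<in>A. b \<le> lower_val f (Minus t) \<and> upper_val f (Plus t) \<le> a"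
proof -
  have "\<exists>f\<in>A. \<exists>x\<in>{b..}. \<exists>y\<in>{..a}. (Pt x t, Pt y t) \<in> graph2 f"
  proof (rule pair_limit[OF A])
    fix e :: real assume "e > 0"
    then obtain f s s' where f: "f \<in> A" "s \<le> s'" "\<bar>base s - t\<bar> < e" "\<bar>base s' - t\<bar> < e"
      "b \<le> lower_val f s" "lower_val f s' \<le> a" using * by meson
    then have "lower_val f s' < lower_val f s" using ab by order
    then have "(Pt (lower_val f s) (base s), Pt (lower_val f s') (base s')) \<in> graph2 f"
      using graph2_downI f A(2) by blast
    then show "\<exists>f\<in>A. \<exists>x\<in>{b..}. \<exists>y\<in>{..a}. \<exists>t1 t2. \<bar>t1 - t\<bar> < e \<and> \<bar>t2 - t\<bar> < e \<and> (Pt x t1, Pt y t2) \<in> graph2 f"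
      using f by fastforce
  qed auto
  then obtain f x y where f: "f \<in> A" "b \<le> x" "y \<le> a" "(Pt x t, Pt y t) \<in> graph2 f" by auto
  then have "y < x" using ab by order
  then have "x \<le> lower_val f (Minus t) \<and> upper_val f (Plus t) \<le> y"
    using graph2_jumpD(1)[OF _ f(4)] f(1) A(2) by blast
  then show ?thesis using f order_trans by blast
qed

lemma up_limit:
  assumes A: "compact A" "A \<subseteq> paths_up" and cd: "c < d"
    and *: "\<And>e. e > 0 \<Longrightarrow> \<exists>f\<in>A. \<exists>s s'. s \<le> s' \<and> \<bar>base s - t\<bar> < e \<and> \<bar>base s' - t\<bar> < e \<and>
      upper_val f s \<le> c \<and> d \<le> upper_val f s'"
  shows "\<exists>f\<in>A. upper_val f (Minus t) \<le> c \<and> d \<le> lower_val f (Plus t)"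
proof -
  have "\<exists>f\<in>A. \<exists>x\<in>{..c}. \<exists>y\<in>{d..}. (Pt x t, Pt y t) \<in> graph2 f"
  proof (rule pair_limit[OF A])
    fix e :: real assume "e > 0"
    then obtain f s s' where f: "f \<in> A" "s \<le> s'" "\<bar>base s - t\<bar> < e" "\<bar>base s' - t\<bar> < e"
      "upper_val f s \<le> c" "d \<le> upper_val f s'" using * by meson
    then have "upper_val f s < upper_val f s'" using cd by order
    then have "(Pt (upper_val f s) (base s), Pt (upper_val f s') (base s')) \<in> graph2 f"
      using graph2_upI f A(2) by blast
    then show "\<exists>f\<in>A. \<exists>x\<in>{..c}. \<exists>y\<in>{d..}. \<exists>t1 t2. \<bar>t1 - t\<bar> < e \<and> \<bar>t2 - t\<bar> < e \<and> (Pt x t1, Pt y t2) \<in> graph2 f"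
      using f by fastforce
  qed auto
  then obtain f x y where f: "f \<in> A" "x \<le> c" "d \<le> y" "(Pt x t, Pt y t) \<in> graph2 f" by auto
  then have "x < y" using cd by order
  then have "upper_val f (Minus t) \<le> x \<and> y \<le> lower_val f (Plus t)"
    using graph2_jumpD(2)[OF _ f(4)] f(1) A(2) by blast
  then show ?thesis using f order_trans by blast
qed

lemma opposite_jumps_cross:
  assumes "f \<in> paths_up" "g \<in> paths_up"
    and "b \<le> lower_val f (Minus t)" "upper_val f (Plus t) \<le> a"
    and "upper_val g (Minus t) \<le> c" "d \<le> lower_val g (Plus t)"
    and "c < b" "a < d"
  shows "crosses f g" "crosses g f"
proof -
  have "upper_val g (Minus t) < lower_val f (Minus t)" "upper_val f (Plus t) < lower_val g (Plus t)"
    using assms(3-) by order+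
  then have "\<not> below f g" "\<not> below g f"
    using assms(1,2) by (auto simp: below_iff not_le)
  then show "crosses f g" "crosses g f" by (simp_all add: crosses_iff)
qed

section \<open>Carrying strict inequalities to nearby times\<close>

lemma frequently_at_leftD:
  fixes t :: real
  assumes "\<exists>\<^sub>F r in at_left t. P r" "u < t"
  obtains r where "u < r" "r < t" "P r"
proof -
  have "\<forall>\<^sub>F r in at_left t. u < r \<and> r < t" using assms(2) by (auto simp: eventually_at_left[of u])
  with assms(1) have "\<exists>\<^sub>F r in at_left t. (u < r \<and> r < t) \<and> P r" by (rule frequently_eventually_conj)
  then show thesis using that frequently_ex by blast
qed

lemma frequently_at_rightD:
  fixes t :: real
  assumes "\<exists>\<^sub>F r in at_right t. P r" "t < u"
  obtains r where "t < r" "r < u" "P r"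
proof -
  have "\<forall>\<^sub>F r in at_right t. t < r \<and> r < u" using assms(2) by (auto simp: eventually_at_right[of t u])
  with assms(1) have "\<exists>\<^sub>F r in at_right t. (t < r \<and> r < u) \<and> P r" by (rule frequently_eventually_conj)
  then show thesis using that frequently_ex by blast
qed

text \<open>The delicate case is the initial t- of \<open>k\<close>, where
  \<open>upper_val k\<close> can be finite although it is infinite just before. Paths of
  \<open>A\<close> that are below \<open>k\<close> but reach y ever closer before t would have to
  fall to k(t-). Their limit would jump down at t against the upward initial jump of
  \<open>k\<close>, and so cross it.\<close>

lemma not_below_if_above:
  assumes A: "compact A" "A \<subseteq> paths_up" and k: "k \<in> paths_up" "\<not> crosses_set k A"
    and y: "upper_val k s < y"
  shows "\<forall>\<^sub>F r in side s. \<forall>g\<in>A. y \<le> lower_val g (Minus r) \<or> y \<le> lower_val g (Plus r) \<longrightarrow> \<not> below g k"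
proof (cases rule: activity_cases[of k s])
  case 1
  show ?thesis
    using eventually_side_vals(2)[OF k(1) 1, of y] y 1
  proof (auto elim!: eventually_mono simp: below_iff k(1) subsetD[OF A(2)] not_le, goal_cases)
    case (1 r g)
    then show ?case by (intro exI[of _ "Minus r"]) simp
  next
    case (2 r g)
    then show ?case by (intro exI[of _ "Plus r"]) (simp add: less_imp_le)
  qed
next
  case (2 t)
  have j: "path_val k (Minus t) < path_val k (Plus t)" "upper_val k (Minus t) = path_val k (Minus t)"
    "upper_val k (Plus t) = path_val k (Plus t)" "lower_val k (Plus t) = path_val k (Plus t)"
    using y 2 by (auto simp: start_vals split: if_splits)
  show ?thesis
  proof (rule ccontr)
    assume "\<not> ?thesis"
    then have fr: "\<exists>\<^sub>F r in at_left t. \<not> (\<forall>g\<in>A. y \<le> lower_val g (Minus r) \<or> y \<le> lower_val g (Plus r) \<longrightarrow> \<not> below g k)"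
      unfolding not_eventually 2 side_simps .
    have "\<exists>f\<in>A. y \<le> lower_val f (Minus t) \<and> upper_val f (Plus t) \<le> upper_val k (Minus t)"
    proof (rule down_limit[OF A])
      show "upper_val k (Minus t) < y" using y 2 by simp
      fix e :: real assume e: "e > 0"
      then have "t - e < t" by simp
      then obtain r g where r: "t - e < r" "r < t" "g \<in> A" "below g k"
        and "y \<le> lower_val g (Minus r) \<or> y \<le> lower_val g (Plus r)"
        using frequently_at_leftD[OF fr, of "t - e"] by blast
      then obtain u where u: "base u = r" "y \<le> lower_val g u" by (metis split_time.sel)
      have "lower_val g (Minus t) \<le> upper_val k (Minus t)"
        using r A(2) k(1) by (auto simp: below_iff)
      then show "\<exists>f\<in>A. \<exists>s s'. s \<le> s' \<and> \<bar>base s - t\<bar> < e \<and> \<bar>base s' - t\<bar> < e \<and>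
        y \<le> lower_val f s \<and> lower_val f s' \<le> upper_val k (Minus t)"
        using r u e by (intro bexI[of _ g] exI[of _ u] exI[of _ "Minus t"]) (auto simp: less_eq_split_time_def)
    qed
    then obtain f where f: "f \<in> A" "y \<le> lower_val f (Minus t)" "upper_val f (Plus t) \<le> upper_val k (Minus t)" by blast
    have "crosses k f"
      by (rule opposite_jumps_cross(2)[OF _ k(1) f(2,3) order_refl order_refl]) (use f(1) A(2) y 2 j in auto)
    then show False using k(2) f(1) by (auto simp: crosses_set_def)
  qed
next
  case 3
  then show ?thesis using y by (simp add: before_vals)
qed

text \<open>The mirror image of \<open>not_below_if_above\<close> under reversal of space.\<close>

lemma not_above_if_below:
  assumes A: "compact A" "A \<subseteq> paths_up" and k: "k \<in> paths_up" "\<not> crosses_set k A"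
    and x: "x < lower_val k s"
  shows "\<forall>\<^sub>F r in side s. \<forall>g\<in>A. upper_val g (Minus r) \<le> x \<or> upper_val g (Plus r) \<le> x \<longrightarrow> \<not> below k g"
proof (cases rule: activity_cases[of k s])
  case 1
  show ?thesis
    using eventually_side_vals(1)[OF k(1) 1, of x] x 1
  proof (auto elim!: eventually_mono simp: below_iff k(1) subsetD[OF A(2)] not_le, goal_cases)
    case (1 r g)
    then show ?case by (intro exI[of _ "Minus r"]) simp
  next
    case (2 r g)
    then show ?case by (intro exI[of _ "Plus r"]) (simp add: less_imp_le)
  qed
next
  case (2 t)
  have j: "path_val k (Plus t) < path_val k (Minus t)" "lower_val k (Minus t) = path_val k (Minus t)"
    "upper_val k (Plus t) = path_val k (Plus t)" "lower_val k (Plus t) = path_val k (Plus t)"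
    using x 2 by (auto simp: start_vals split: if_splits)
  show ?thesis
  proof (rule ccontr)
    assume "\<not> ?thesis"
    then have fr: "\<exists>\<^sub>F r in at_left t. \<not> (\<forall>g\<in>A. upper_val g (Minus r) \<le> x \<or> upper_val g (Plus r) \<le> x \<longrightarrow> \<not> below k g)"
      unfolding not_eventually 2 side_simps .
    have "\<exists>f\<in>A. upper_val f (Minus t) \<le> x \<and> lower_val k (Minus t) \<le> lower_val f (Plus t)"
    proof (rule up_limit[OF A])
      show "x < lower_val k (Minus t)" using x 2 by simp
      fix e :: real assume e: "e > 0"
      then have "t - e < t" by simp
      then obtain r g where r: "t - e < r" "r < t" "g \<in> A" "below k g"
        and "upper_val g (Minus r) \<le> x \<or> upper_val g (Plus r) \<le> x"
        using frequently_at_leftD[OF fr, of "t - e"] by blast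
      then obtain u where u: "base u = r" "upper_val g u \<le> x" by (metis split_time.sel)
      have "lower_val k (Minus t) \<le> upper_val g (Minus t)"
        using r A(2) k(1) by (auto simp: below_iff)
      then show "\<exists>f\<in>A. \<exists>s s'. s \<le> s' \<and> \<bar>base s - t\<bar> < e \<and> \<bar>base s' - t\<bar> < e \<and>
        upper_val f s \<le> x \<and> lower_val k (Minus t) \<le> upper_val f s'"
        using r u e by (intro bexI[of _ g] exI[of _ u] exI[of _ "Minus t"]) (auto simp: less_eq_split_time_def)
    qed
    then obtain f where f: "f \<in> A" "upper_val f (Minus t) \<le> x" "lower_val k (Minus t) \<le> lower_val f (Plus t)" by blast
    have "crosses k f"
      by (rule opposite_jumps_cross(1)[OF k(1) _ order_refl order_refl f(2,3)]) (use f(1) A(2) x 2 j in auto)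
    then show False using k(2) f(1) by (auto simp: crosses_set_def)
  qed
next
  case 3
  then show ?thesis using x by (simp add: before_vals)
qed

section \<open>Cuts and their boundaries\<close>

text \<open>In the split topology t- is approached only from earlier times and t+ only from later
  ones, with r- and r+ entering a neighbourhood together. So \<open>side s\<close> is the filter of
  punctured neighbourhoods of s, read on base times.\<close>

lemma eventually_side_open:
  fixes s :: "real split_time"
  assumes "open V" "s \<in> V"
  shows "\<forall>\<^sub>F r in side s. Minus r \<in> V \<and> Plus r \<in> V"
proof (cases s)
  case (Minus t)
  have "Minus (t - 1) < s" by (simp add: Minus less_split_time_def)
  then obtain b where b: "b < s" "{b<..s} \<subseteq> V" using open_left[OF assms] by blast
  then have "base b < t" by (cases b) (auto simp: Minus less_split_time_def)
  moreover have "Minus r \<in> V \<and> Plus r \<in> V" if "base b < r" "r < t" for r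
    using b(2) that Minus by (auto simp: less_split_time_def less_eq_split_time_def intro!: subsetD[OF b(2)])
  ultimately show ?thesis by (auto simp: Minus eventually_at_left)
next
  case (Plus t)
  have "s < Plus (t + 1)" by (simp add: Plus less_split_time_def)
  then obtain b where b: "b > s" "{s..<b} \<subseteq> V" using open_right[OF assms] by blast
  then have "t < base b" by (cases b) (auto simp: Plus less_split_time_def)
  moreover have "Minus r \<in> V \<and> Plus r \<in> V" if "t < r" "r < base b" for r
    using b(2) that Plus by (auto simp: less_split_time_def less_eq_split_time_def intro!: subsetD[OF b(2)])
  ultimately show ?thesis by (auto simp: Plus eventually_at_right)
qed

lemma eventually_side_obtain_open:
  assumes "\<forall>\<^sub>F r in side s. Q r"
  obtains V where "open V" "s \<in> V" "\<And>s'. s' \<in> V \<Longrightarrow> s' \<noteq> s \<Longrightarrow> Q (base s')"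
proof (cases s)
  case (Minus t)
  have "t - 1 < t" by simp
  from eventually_at_left[OF this, of Q] obtain b where b: "b < t" "\<And>r. b < r \<Longrightarrow> r < t \<Longrightarrow> Q r"
    using assms Minus by auto
  have "s \<in> {Plus b<..<Plus t}" using b(1) Minus by (simp add: less_split_time_def)
  moreover have "Q (base s')" if "s' \<in> {Plus b<..<Plus t}" "s' \<noteq> s" for s'
    using that Minus by (cases s') (auto simp: less_split_time_def intro: b(2))
  ultimately show thesis using that open_greaterThanLessThan by blast
next
  case (Plus t)
  have "t < t + 1" by simp
  from eventually_at_right[OF this, of Q] obtain b where b: "t < b" "\<And>r. t < r \<Longrightarrow> r < b \<Longrightarrow> Q r"
    using assms Plus by auto
  have "s \<in> {Minus t<..<Minus b}" using b(1) Plus by (simp add: less_split_time_def)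
  moreover have "Q (base s')" if "s' \<in> {Minus t<..<Minus b}" "s' \<noteq> s" for s'
    using that Plus by (cases s') (auto simp: less_split_time_def intro: b(2))
  ultimately show thesis using that open_greaterThanLessThan by blast
qed

section \<open>The boundary of a set of paths\<close>

lemma lower_val_le_cut_boundary:
  assumes "f \<in> X"
  shows "lower_val f s \<le> cut_boundary X s"
proof (rule dense_le)
  fix x assume "x < lower_val f s"
  then have "(x, s) \<in> closure (cut_lower_set X)"
    using assms closure_subset by (fastforce simp: cut_lower_set_eq)
  then show "x \<le> cut_boundary X s" by (auto simp: cut_boundary_def intro: Sup_upper)
qed

lemma cut_boundary_less:
  assumes "cut_boundary X s < y"
  obtains V where "open V" "s \<in> V" "\<And>s' f. s' \<in> V \<Longrightarrow> f \<in> X \<Longrightarrow> lower_val f s' \<le> y"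
proof -
  have "(y, s) \<notin> closure (cut_lower_set X)"
  proof
    assume "(y, s) \<in> closure (cut_lower_set X)"
    then have "y \<le> cut_boundary X s" by (auto simp: cut_boundary_def intro: Sup_upper)
    then show False using assms by simp
  qed
  then have "(y, s) \<in> - closure (cut_lower_set X)" "open (- closure (cut_lower_set X))" by auto
  then obtain U V where UV: "open U" "open V" "(y, s) \<in> U \<times> V" "U \<times> V \<subseteq> - closure (cut_lower_set X)"
    using open_prod_elim by metis
  have "lower_val f s' \<le> y" if "s' \<in> V" "f \<in> X" for s' f
  proof (rule ccontr)
    assume "\<not> lower_val f s' \<le> y"
    then have "(y, s') \<in> cut_lower_set X" using that by (auto simp: cut_lower_set_eq not_le)
    moreover have "(y, s') \<in> U \<times> V" using UV(3) that by simp
    ultimately show False using UV(4) closure_subset by blast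
  qed
  then show thesis using that UV by blast
qed

lemma less_cut_boundary:
  assumes "y < cut_boundary X s" "open V" "s \<in> V"
  obtains s' f where "s' \<in> V" "f \<in> X" "y < lower_val f s'"
proof -
  obtain x where x: "(x, s) \<in> closure (cut_lower_set X)" "y < x"
    using assms(1) by (auto simp: cut_boundary_def less_Sup_iff)
  have "open ({y<..} \<times> V)" using assms(2) by (intro open_Times) auto
  then have "({y<..} \<times> V) \<inter> cut_lower_set X \<noteq> {}"
    using x assms(3) open_Int_closure_eq_empty[of "{y<..} \<times> V" "cut_lower_set X"] by blast
  then obtain x' s' f where "y < x'" "s' \<in> V" "f \<in> X" "x' < lower_val f s'"
    by (auto simp: cut_lower_set_eq)
  then show thesis by (intro that[of s' f]) (auto intro: less_trans)
qed

text \<open>The values of the hull come from split times near s, and \<open>upper_val k\<close> need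
  not be upper semicontinuous. \<open>not_below_if_above\<close> handles the split times s' \<noteq>
  s, and \<open>below f k\<close> handles s itself.\<close>

lemma cut_boundary_le_upper_val:
  assumes A: "compact A" "A \<subseteq> paths_up" and k: "k \<in> paths_up" "\<not> crosses_set k A"
    and X: "X \<subseteq> A" "\<And>g. g \<in> X \<Longrightarrow> below g k"
  shows "cut_boundary X s \<le> upper_val k s"
proof (rule ccontr)
  assume "\<not> ?thesis"
  then obtain b where b: "upper_val k s < b" "b < cut_boundary X s" by (meson dense not_le)
  obtain V where V: "open V" "s \<in> V" "\<And>s'. s' \<in> V \<Longrightarrow> s' \<noteq> s \<Longrightarrow>
      (\<forall>g\<in>A. b \<le> lower_val g (Minus (base s')) \<or> b \<le> lower_val g (Plus (base s')) \<longrightarrow> \<not> below g k)"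
    using eventually_side_obtain_open[OF not_below_if_above[OF A k b(1)]] by blast
  obtain s' f where s': "s' \<in> V" "f \<in> X" "b < lower_val f s'"
    using less_cut_boundary[OF b(2) V(1,2)] by blast
  have f: "f \<in> A" "below f k" "f \<in> paths_up" using s'(2) X A(2) by auto
  show False
  proof (cases "s' = s")
    case True
    have "lower_val f s \<le> upper_val k s" using f k(1) by (simp add: below_iff)
    then show False using b(1) s'(3)[unfolded True] by order
  next
    case False
    have "b \<le> lower_val f (Minus (base s')) \<or> b \<le> lower_val f (Plus (base s'))"
      using s'(3) by (cases s') (auto intro: less_imp_le)
    then show False using V(3)[OF s'(1) False] f by blast
  qed
qed

section \<open>Cuts in a deterministic weave\<close>

context
  fixes A :: "path set"
  assumes weave: "deterministic_weave A"
begin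

lemma weave_up: "A \<subseteq> paths_up"
  and weave_compact: "compact A"
  and weave_not_crosses: "f \<in> A \<Longrightarrow> \<not> crosses_set f A"
  using weave by (auto simp: deterministic_weave_def crosses_set_def)

lemma max_pathsD: "f \<in> max_paths A \<Longrightarrow> f \<in> A" "f \<in> max_paths A \<Longrightarrow> f \<in> paths_up"
  using weave_up by (auto simp: max_paths_def)

lemma max_paths_below_antisym:
  assumes "f \<in> max_paths A" "g \<in> max_paths A" "below f g" "below g f"
  shows "f = g"
proof -
  have "extended_by f g \<or> extended_by g f"
    using assms by (intro below_antisym max_pathsD(2))
  then show ?thesis using assms(1,2) unfolding max_paths_def by blast
qed

text \<open>Passing to a maximal extension narrows the interval between the bounds, so the
  inequalities given by a point of the graph survive.\<close>

lemma max_path_through: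
  obtains k where "k \<in> max_paths A"
    "x \<le> lower_val k (Minus r) \<or> x \<le> lower_val k (Plus r)"
    "upper_val k (Minus r) \<le> x \<or> upper_val k (Plus r) \<le> x"
proof -
  obtain f where f: "f \<in> A" "Pt x r \<in> graph f" using weave unfolding deterministic_weave_def by blast
  obtain k where k: "k \<in> max_paths A" "extended_by f k"
    using maximal_extension[OF weave_compact weave_up f(1)] by blast
  have fu: "f \<in> paths_up" using f weave_up by blast
  have le: "lower_val f s \<le> lower_val k s \<and> upper_val k s \<le> upper_val f s" for s
    using k fu max_pathsD(2) by (simp add: extended_by_iff)
  show thesis
    using graph_vals[OF fu f(2)] le by (intro that[OF k(1)]) (meson order_trans)+
qed

text \<open>Being below in both directions is the same as being comparable under extension, so the
  two extension conditions of \<open>cut_of\<close> express strictness.\<close>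

lemma cut_of_eq:
  assumes "h \<in> paths_up"
  shows "cut_of A h = {g \<in> max_paths A. below g h \<and> \<not> below h g}"
  using extended_by_imp_below below_antisym assms max_pathsD(2) unfolding cut_of_def by blast

lemma not_crosses_setD:
  assumes "\<not> crosses_set f A" "g \<in> A"
  shows "below f g \<or> below g f"
  using assms by (auto simp: crosses_set_def crosses_iff)

lemma cut_of_dedekind:
  assumes f: "f \<in> paths_up" "\<not> crosses_set f A"
  shows "cut_of A f \<in> dedekind_cuts A"
  unfolding dedekind_cuts_def
proof (intro CollectI conjI ballI impI notI)
  show "cut_of A f \<subseteq> max_paths A" by (auto simp: cut_of_def)
next
  fix g h assume g: "g \<in> max_paths A" and h: "h \<in> max_paths A" and gh: "below g h \<and> h \<in> cut_of A f"
  then have h': "below h f" "\<not> below f h" by (auto simp: cut_of_eq[OF f(1)])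
  show "g \<in> cut_of A f"
  proof (cases "below f g")
    case True
    \<comment> \<open>Here f \<triangleleft> g \<triangleleft> h \<triangleleft> f would be a cycle
      unless f \<triangleleft> h or h \<triangleleft> g. All three relations of a cycle do hold up
      to relabelling, and f \<triangleleft> h is excluded by strictness of h.\<close>
    then have "below h g"
      using below_cycle[of f g h] f g h gh h' max_pathsD(2) by blast
    then have "g = h" using max_paths_below_antisym g h gh by blast
    then show ?thesis using gh by simp
  next
    case False
    then show ?thesis using not_crosses_setD[OF f(2)] g max_pathsD(1) by (auto simp: cut_of_eq[OF f(1)])
  qed
next
  assume "\<exists>m\<in>cut_of A f. \<forall>g\<in>cut_of A f. below m g \<longrightarrow> g = m"
  then obtain m where m: "m \<in> max_paths A" "below m f" "\<not> below f m"
    and max: "\<And>g. g \<in> cut_of A f \<Longrightarrow> below m g \<Longrightarrow> g = m"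
    by (auto simp: cut_of_eq[OF f(1)])
  \<comment> \<open>\<open>m\<close> is strictly below \<open>f\<close> at s. A maximal path through
    level x at a time just beside s is then neither below \<open>m\<close> nor above
    \<open>f\<close>, so it is a larger element of the cut.\<close>
  obtain s where "upper_val m s < lower_val f s"
    using m f(1) max_pathsD(2) by (auto simp: below_iff not_le)
  then obtain x where x: "upper_val m s < x" "x < lower_val f s" using dense by blast
  have "\<forall>\<^sub>F r in side s. \<forall>g\<in>A. x \<le> lower_val g (Minus r) \<or> x \<le> lower_val g (Plus r) \<longrightarrow> \<not> below g m"
    using m max_pathsD weave_not_crosses x(1) by (intro not_below_if_above weave_compact weave_up) auto
  moreover have "\<forall>\<^sub>F r in side s. \<forall>g\<in>A. upper_val g (Minus r) \<le> x \<or> upper_val g (Plus r) \<le> x \<longrightarrow> \<not> below f g"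
    using f x(2) by (intro not_above_if_below weave_compact weave_up)
  ultimately have "\<forall>\<^sub>F r in side s. (\<forall>g\<in>A. x \<le> lower_val g (Minus r) \<or> x \<le> lower_val g (Plus r) \<longrightarrow> \<not> below g m) \<and>
      (\<forall>g\<in>A. upper_val g (Minus r) \<le> x \<or> upper_val g (Plus r) \<le> x \<longrightarrow> \<not> below f g)"
    by (rule eventually_conj)
  from eventually_happens'[OF side_nontrivial this] obtain r where r: "\<And>g. g \<in> A \<Longrightarrow> x \<le> lower_val g (Minus r) \<or> x \<le> lower_val g (Plus r) \<Longrightarrow> \<not> below g m"
      "\<And>g. g \<in> A \<Longrightarrow> upper_val g (Minus r) \<le> x \<or> upper_val g (Plus r) \<le> x \<Longrightarrow> \<not> below f g"
    by blast
  obtain k where k: "k \<in> max_paths A"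
    "x \<le> lower_val k (Minus r) \<or> x \<le> lower_val k (Plus r)"
    "upper_val k (Minus r) \<le> x \<or> upper_val k (Plus r) \<le> x"
    using max_path_through by blast
  have kA: "k \<in> A" using k(1) max_pathsD by blast
  have km: "\<not> below k m" "\<not> below f k" using r kA k by blast+
  then have "k \<in> cut_of A f"
    using not_crosses_setD[OF f(2) kA] k(1) by (simp add: cut_of_eq[OF f(1)])
  moreover have "below m k"
    using km(1) not_crosses_setD[OF weave_not_crosses, of m k] m(1) max_pathsD kA by blast
  ultimately have "k = m" using max by blast
  then show False using km(1) m(1) max_pathsD below_refl by blast
qed

lemma cut_boundary_cut_of:
  assumes f: "f \<in> paths_up" "\<not> crosses_set f A"
  shows "lower_val f s \<le> cut_boundary (cut_of A f) s \<and> cut_boundary (cut_of A f) s \<le> upper_val f s"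
proof
  show "cut_boundary (cut_of A f) s \<le> upper_val f s"
    by (rule cut_boundary_le_upper_val[OF weave_compact weave_up f])
      (auto simp: cut_of_eq[OF f(1)] max_pathsD)
  show "lower_val f s \<le> cut_boundary (cut_of A f) s"
  proof (rule ccontr)
    assume "\<not> ?thesis"
    then obtain x where x: "cut_boundary (cut_of A f) s < x" "x < lower_val f s" by (meson dense not_le)
    then obtain y where y: "cut_boundary (cut_of A f) s < y" "y < x" using dense by blast
    obtain V where V: "open V" "s \<in> V" "\<And>s' g. s' \<in> V \<Longrightarrow> g \<in> cut_of A f \<Longrightarrow> lower_val g s' \<le> y"
      using cut_boundary_less[OF y(1)] by blast
    have "\<forall>\<^sub>F r in side s. (Minus r \<in> V \<and> Plus r \<in> V) \<and>
        (\<forall>g\<in>A. upper_val g (Minus r) \<le> x \<or> upper_val g (Plus r) \<le> x \<longrightarrow> \<not> below f g)"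
      using eventually_side_open[OF V(1,2)] not_above_if_below[OF weave_compact weave_up f x(2)]
      by (rule eventually_conj)
    from eventually_happens'[OF side_nontrivial this] obtain r where r: "Minus r \<in> V" "Plus r \<in> V"
      "\<And>g. g \<in> A \<Longrightarrow> upper_val g (Minus r) \<le> x \<or> upper_val g (Plus r) \<le> x \<Longrightarrow> \<not> below f g"
      by blast
    \<comment> \<open>A maximal path through (x, r) is not above \<open>f\<close>, so it belongs to
      the cut; yet it exceeds y at r- or r+, inside V.\<close>
    obtain k where k: "k \<in> max_paths A"
      "x \<le> lower_val k (Minus r) \<or> x \<le> lower_val k (Plus r)"
      "upper_val k (Minus r) \<le> x \<or> upper_val k (Plus r) \<le> x"
      using max_path_through by blast
    have kA: "k \<in> A" using k(1) max_pathsD by blast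
    have "\<not> below f k" using r(3) kA k(3) by blast
    then have "k \<in> cut_of A f"
      using not_crosses_setD[OF f(2) kA] k(1) by (simp add: cut_of_eq[OF f(1)])
    then have "lower_val k (Minus r) \<le> y" "lower_val k (Plus r) \<le> y" using V(3) r by blast+
    then show False using k(2) y(2) by (meson leD order_trans)
  qed
qed

lemma dedekind_cutD:
  assumes "X \<in> dedekind_cuts A"
  shows "X \<subseteq> max_paths A" "X \<subseteq> A"
    and "f \<in> X \<Longrightarrow> g \<in> max_paths A \<Longrightarrow> g \<notin> X \<Longrightarrow> below f g"
    and "f \<in> X \<Longrightarrow> \<exists>g\<in>X. below f g \<and> g \<noteq> f"
proof -
  show X: "X \<subseteq> max_paths A" using assms by (auto simp: dedekind_cuts_def)
  then show "X \<subseteq> A" using max_pathsD by blast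
  show "f \<in> X \<Longrightarrow> \<exists>g\<in>X. below f g \<and> g \<noteq> f" using assms by (auto simp: dedekind_cuts_def)
  assume f: "f \<in> X" and g: "g \<in> max_paths A" "g \<notin> X"
  have "\<not> below g f" using assms f g X unfolding dedekind_cuts_def by blast
  then show "below f g" using not_crosses_setD[OF weave_not_crosses] f g X max_pathsD by blast
qed

section \<open>Regularity of the cut boundary\<close>

lemma cut_boundary_eventually_greater:
  assumes X: "X \<in> dedekind_cuts A" and b: "b < cut_boundary X s"
  shows "\<forall>\<^sub>F r in side s. b < cut_boundary X (Minus r) \<and> b < cut_boundary X (Plus r)"
proof (rule ccontr)
  assume "\<not> ?thesis"
  then have fr: "\<exists>\<^sub>F r in side s. \<not> (b < cut_boundary X (Minus r) \<and> b < cut_boundary X (Plus r))"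
    by (simp only: not_eventually)
  \<comment> \<open>b0 exceeds b, so that a boundary value \<le> b keeps all nearby lower values of
    \<open>X\<close> at most b0. b1 exceeds b0, so that maximal paths through level b1 at such times
    lie outside \<open>X\<close>. b2 exceeds b1, so that lower values above b2 do not occur at s
    itself and the two final jumps overlap.\<close>
  obtain b2 where b2: "b < b2" "b2 < cut_boundary X s" using b dense by blast
  obtain b1 where b1: "b < b1" "b1 < b2" using b2(1) dense by blast
  obtain b0 where b0: "b < b0" "b0 < b1" using b1(1) dense by blast
  define low where "low r \<longleftrightarrow> (\<forall>f\<in>X. lower_val f (Minus r) \<le> b0 \<and> lower_val f (Plus r) \<le> b0)" for r
  have low: "\<exists>\<^sub>F r in side s. low r"
  proof (rule ccontr)
    assume "\<not> ?thesis"
    then have "\<forall>\<^sub>F r in side s. \<not> low r" by (simp only: not_frequently)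
    then obtain V where V: "open V" "s \<in> V" "\<And>s'. s' \<in> V \<Longrightarrow> s' \<noteq> s \<Longrightarrow> \<not> low (base s')"
      using eventually_side_obtain_open by blast
    have "\<forall>\<^sub>F r in side s. r \<noteq> base s"
      by (cases s) (auto simp: eventually_at_filter)
    with eventually_side_open[OF V(1,2)] have "\<forall>\<^sub>F r in side s. (Minus r \<in> V \<and> Plus r \<in> V) \<and> r \<noteq> base s"
      by (rule eventually_conj)
    with fr have "\<exists>\<^sub>F r in side s. ((Minus r \<in> V \<and> Plus r \<in> V) \<and> r \<noteq> base s) \<and>
        \<not> (b < cut_boundary X (Minus r) \<and> b < cut_boundary X (Plus r))"
      by (rule frequently_eventually_conj)
    then obtain r where r: "Minus r \<in> V" "Plus r \<in> V" "r \<noteq> base s"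
        "\<not> (b < cut_boundary X (Minus r) \<and> b < cut_boundary X (Plus r))"
      using frequently_ex by blast
    \<comment> \<open>The boundary is known to be small at one of r- and r+, whereas
      \<open>low\<close> concerns both. A neighbourhood of that one point contains a whole pair r'-,
      r'+.\<close>
    then obtain s' where s': "s' \<in> V" "s' \<noteq> s" "cut_boundary X s' \<le> b" by (metis not_le split_time.sel)
    then have "cut_boundary X s' < b0" using b0(1) by order
    then obtain V' where V': "open V'" "s' \<in> V'" "\<And>s'' f. s'' \<in> V' \<Longrightarrow> f \<in> X \<Longrightarrow> lower_val f s'' \<le> b0"
      using cut_boundary_less by blast
    have "open (V \<inter> V' - {s})" "s' \<in> V \<inter> V' - {s}" using V V' s' by auto
    from eventually_happens'[OF side_nontrivial eventually_side_open[OF this]]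
    obtain r' where "Minus r' \<in> V \<inter> V' - {s}" "Plus r' \<in> V \<inter> V' - {s}" by blast
    then show False using V(3)[of "Minus r'"] V'(3) by (auto simp: low_def)
  qed
  have outer: "\<exists>k\<in>max_paths A. k \<notin> X \<and> (upper_val k (Minus r) \<le> b1 \<or> upper_val k (Plus r) \<le> b1)" if "low r" for r
  proof -
    obtain k where k: "k \<in> max_paths A"
      "b1 \<le> lower_val k (Minus r) \<or> b1 \<le> lower_val k (Plus r)"
      "upper_val k (Minus r) \<le> b1 \<or> upper_val k (Plus r) \<le> b1"
      using max_path_through by blast
    have "k \<notin> X" using k(2) that b0(2) unfolding low_def by (meson leD order_trans)
    then show ?thesis using k by blast
  qed
  \<comment> \<open>Otherwise no path of \<open>A\<close> above \<open>f\<close> could dip to b1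
    just beside s, but the maximal paths outside \<open>X\<close> supplied by \<open>outer\<close>
    do so and lie above \<open>f\<close>.\<close>
  have le_b1: "lower_val f s \<le> b1" if f: "f \<in> X" for f
  proof (rule ccontr)
    assume "\<not> ?thesis"
    then have "b1 < lower_val f s" by simp
    then have "\<forall>\<^sub>F r in side s. \<forall>g\<in>A. upper_val g (Minus r) \<le> b1 \<or> upper_val g (Plus r) \<le> b1 \<longrightarrow> \<not> below f g"
      using f dedekind_cutD(2)[OF X] weave_up weave_not_crosses
      by (intro not_above_if_below weave_compact weave_up) auto
    with low have "\<exists>\<^sub>F r in side s. (\<forall>g\<in>A. upper_val g (Minus r) \<le> b1 \<or> upper_val g (Plus r) \<le> b1 \<longrightarrow> \<not> below f g) \<and> low r"
      by (rule frequently_eventually_conj)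
    then obtain r where r: "low r" "\<And>g. g \<in> A \<Longrightarrow> upper_val g (Minus r) \<le> b1 \<or> upper_val g (Plus r) \<le> b1 \<Longrightarrow> \<not> below f g"
      using frequently_ex by blast
    then obtain k where "k \<in> max_paths A" "k \<notin> X" "upper_val k (Minus r) \<le> b1 \<or> upper_val k (Plus r) \<le> b1"
      using outer by blast
    then show False using r(2) dedekind_cutD(3)[OF X f] max_pathsD by blast
  qed
  have high: "\<exists>s'\<in>V. s' \<noteq> s \<and> (\<exists>f\<in>X. b2 < lower_val f s')" if V: "open V" "s \<in> V" for V
  proof -
    obtain s' f where "s' \<in> V" "f \<in> X" "b2 < lower_val f s'" using less_cut_boundary[OF b2(2) V] by blast
    then show ?thesis using le_b1 b1(2) by (metis leD less_le_trans order.strict_trans)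
  qed
  \<comment> \<open>A path of \<open>X\<close> falls from \<open>b2\<close> to \<open>b0\<close> arbitrarily close to the split time \<open>s\<close>, and a maximal path
    outside \<open>X\<close> climbs from \<open>b1\<close> to \<open>b2\<close>; the limits of these paths cross.\<close>
  have "(\<forall>e>0. \<exists>f\<in>A. \<exists>u v. u \<le> v \<and> \<bar>base u - base s\<bar> < e \<and> \<bar>base v - base s\<bar> < e \<and>
        b2 \<le> lower_val f u \<and> lower_val f v \<le> b0) \<and>
      (\<forall>e>0. \<exists>f\<in>A. \<exists>u v. u \<le> v \<and> \<bar>base u - base s\<bar> < e \<and> \<bar>base v - base s\<bar> < e \<and>
        upper_val f u \<le> b1 \<and> b2 \<le> upper_val f v)"
  proof (intro conjI allI impI)
    fix e :: real assume e: "e > 0"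
    \<comment> \<open>High and low times both accumulate at s. Choosing first the one farther from s
      and then the other one between it and s realises either order in time.\<close>
    obtain f u v where fuv: "f \<in> X" "u \<le> v" "\<bar>base u - base s\<bar> < e" "\<bar>base v - base s\<bar> < e" "b2 < lower_val f u" "low (base v)"
    proof (cases s)
      case (Plus t)
      obtain r where r: "t < r" "r < t + e" "low r"
        using frequently_at_rightD[OF low[unfolded Plus side_simps], of "t + e"] e by auto
      have "s \<in> {Minus t<..<Minus r}" using r Plus by (simp add: less_split_time_def)
      then obtain s' f where s': "s' \<in> {Minus t<..<Minus r}" "s' \<noteq> s" "f \<in> X" "b2 < lower_val f s'"
        using high[OF open_greaterThanLessThan] by blast
      then have "t < base s'" "base s' < r" using Plus by (cases s'; auto simp: less_split_time_def)+
      then show thesis using that[of f s' "Minus r"] s' r Plus by (auto simp: less_eq_split_time_def)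
    next
      case (Minus t)
      have "s \<in> {Plus (t - e)<..<Plus t}" using e Minus by (simp add: less_split_time_def)
      then obtain s' f where s': "s' \<in> {Plus (t - e)<..<Plus t}" "s' \<noteq> s" "f \<in> X" "b2 < lower_val f s'"
        using high[OF open_greaterThanLessThan] by blast
      then have s'': "t - e < base s'" "base s' < t" using Minus by (cases s'; auto simp: less_split_time_def)+
      obtain r where r: "base s' < r" "r < t" "low r"
        using frequently_at_leftD[OF low[unfolded Minus side_simps] s''(2)] by blast
      then show thesis using that[of f s' "Minus r"] s' s'' Minus by (auto simp: less_eq_split_time_def)
    qed
    then have "lower_val f v \<le> b0" by (cases v) (auto simp: low_def)
    then show "\<exists>f\<in>A. \<exists>u v. u \<le> v \<and> \<bar>base u - base s\<bar> < e \<and> \<bar>base v - base s\<bar> < e \<and>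
        b2 \<le> lower_val f u \<and> lower_val f v \<le> b0"
      using fuv dedekind_cutD(2)[OF X] less_imp_le by blast
  next
    fix e :: real assume e: "e > 0"
    obtain f r v where frv: "f \<in> X" "r < base v" "\<bar>r - base s\<bar> < e" "\<bar>base v - base s\<bar> < e" "b2 < lower_val f v" "low r"
    proof (cases s)
      case (Plus t)
      have "s \<in> {Minus t<..<Minus (t + e)}" using e Plus by (simp add: less_split_time_def)
      then obtain s' f where s': "s' \<in> {Minus t<..<Minus (t + e)}" "s' \<noteq> s" "f \<in> X" "b2 < lower_val f s'"
        using high[OF open_greaterThanLessThan] by blast
      then have s'': "t < base s'" "base s' < t + e" using Plus by (cases s'; auto simp: less_split_time_def)+
      obtain r where r: "t < r" "r < base s'" "low r"
        using frequently_at_rightD[OF low[unfolded Plus side_simps] s''(1)] by blast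
      then show thesis using that[of f r s'] s' s'' Plus by auto
    next
      case (Minus t)
      obtain r where r: "t - e < r" "r < t" "low r"
        using frequently_at_leftD[OF low[unfolded Minus side_simps], of "t - e"] e by auto
      have "s \<in> {Plus r<..<Plus t}" using r Minus by (simp add: less_split_time_def)
      then obtain s' f where s': "s' \<in> {Plus r<..<Plus t}" "s' \<noteq> s" "f \<in> X" "b2 < lower_val f s'"
        using high[OF open_greaterThanLessThan] by blast
      then have "r < base s'" "base s' < t" using Minus by (cases s'; auto simp: less_split_time_def)+
      then show thesis using that[of f r s'] s' r Minus by auto
    qed
    obtain k where k: "k \<in> max_paths A" "k \<notin> X" "upper_val k (Minus r) \<le> b1 \<or> upper_val k (Plus r) \<le> b1"
      using outer[OF frv(6)] by blast
    then obtain u where u: "base u = r" "upper_val k u \<le> b1" by (metis split_time.sel)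
    have "below f k" using dedekind_cutD(3)[OF X frv(1)] k by blast
    then have "lower_val f v \<le> upper_val k v"
      using frv(1) k(1) dedekind_cutD(1)[OF X] max_pathsD(2) below_iff by blast
    then have "b2 \<le> upper_val k v" using frv(5) by order
    moreover have "u \<le> v" using u(1) frv(2) by (simp add: less_eq_split_time_def)
    ultimately show "\<exists>f\<in>A. \<exists>u v. u \<le> v \<and> \<bar>base u - base s\<bar> < e \<and> \<bar>base v - base s\<bar> < e \<and>
        upper_val f u \<le> b1 \<and> b2 \<le> upper_val f v"
      using u frv(3,4) max_pathsD(1)[OF k(1)] by blast
  qed
  moreover have "b0 < b2" using b0(2) b1(2) by order
  ultimately obtain f g where fg: "f \<in> A" "b2 \<le> lower_val f (Minus (base s))" "upper_val f (Plus (base s)) \<le> b0"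
      "g \<in> A" "upper_val g (Minus (base s)) \<le> b1" "b2 \<le> lower_val g (Plus (base s))"
    using down_limit[OF weave_compact weave_up, of b0 b2 "base s"]
      up_limit[OF weave_compact weave_up b1(2), of "base s"] by metis
  have "crosses f g"
    by (rule opposite_jumps_cross(1)[OF _ _ fg(2,3,5,6)]) (use fg weave_up b1 \<open>b0 < b2\<close> in auto)
  then show False using weave_not_crosses[OF fg(1)] fg(4) by (auto simp: crosses_set_def)
qed

text \<open>This half of the regularity is the upper semicontinuity built into the closure.\<close>

lemma cut_boundary_eventually_less:
  assumes y: "cut_boundary X s < y"
  shows "\<forall>\<^sub>F r in side s. cut_boundary X (Minus r) < y \<and> cut_boundary X (Plus r) < y"
proof -
  obtain y' where y': "cut_boundary X s < y'" "y' < y" using y dense by blast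
  obtain V where V: "open V" "s \<in> V" "\<And>s' f. s' \<in> V \<Longrightarrow> f \<in> X \<Longrightarrow> lower_val f s' \<le> y'"
    using cut_boundary_less[OF y'(1)] by blast
  have "cut_boundary X s' \<le> y'" if s': "s' \<in> V" for s'
  proof (rule ccontr)
    assume "\<not> ?thesis"
    then have "y' < cut_boundary X s'" by simp
    then obtain u f where "u \<in> V" "f \<in> X" "y' < lower_val f u"
      using less_cut_boundary[OF _ V(1) s'] by blast
    then show False using V(3) by (meson leD)
  qed
  then have le: "s' \<in> V \<Longrightarrow> cut_boundary X s' < y" for s' using y'(2) order_le_less_trans by blast
  show ?thesis using eventually_side_open[OF V(1,2)] by eventually_elim (simp add: le)
qed

lemma cadlag_cut_boundary:
  assumes X: "X \<in> dedekind_cuts A"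
  shows "cadlag (-\<infinity>) \<infinity> (cut_boundary X)"
  unfolding cadlag_UNIV_iff
proof (intro allI conjI order_tendstoI)
  fix s y assume "y < cut_boundary X s"
  from cut_boundary_eventually_greater[OF X this]
  show "\<forall>\<^sub>F r in side s. y < cut_boundary X (Plus r)" "\<forall>\<^sub>F r in side s. y < cut_boundary X (Minus r)"
    by (auto elim: eventually_mono)
next
  fix s y assume "cut_boundary X s < y"
  from cut_boundary_eventually_less[OF this]
  show "\<forall>\<^sub>F r in side s. cut_boundary X (Plus r) < y" "\<forall>\<^sub>F r in side s. cut_boundary X (Minus r) < y"
    by (auto elim: eventually_mono)
qed

section \<open>The correspondence between flow and cuts\<close>

lemma cut_boundary_le_outside:
  assumes X: "X \<in> dedekind_cuts A" and k: "k \<in> max_paths A" "k \<notin> X"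
  shows "cut_boundary X s \<le> upper_val k s"
  using k max_pathsD weave_not_crosses dedekind_cutD[OF X]
  by (intro cut_boundary_le_upper_val[OF weave_compact weave_up]) auto

lemma cut_path:
  assumes X: "X \<in> dedekind_cuts A"
  defines "h \<equiv> biinfinite_path (cut_boundary X)"
  shows "h \<in> paths_up" "lower_val h = cut_boundary X" "upper_val h = cut_boundary X"
    and "h \<in> flow A" "cut_of A h = X"
proof -
  note h = biinfinite_path[OF cadlag_cut_boundary[OF X], folded h_def]
  show hu: "h \<in> paths_up" and hl: "lower_val h = cut_boundary X" and hh: "upper_val h = cut_boundary X"
    using updown_vals[OF h(1)] h(2) by auto
  have "\<not> crosses h k" if k: "k \<in> A" for k
  proof -
    have ku: "k \<in> paths_up" using k weave_up by blast
    \<comment> \<open>The bounds of a maximal extension are narrower, so it suffices to compare with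
      \<open>g\<close>: if it lies in \<open>X\<close> it is below the boundary, otherwise
      above.\<close>
    obtain g where g: "g \<in> max_paths A" "extended_by k g"
      using maximal_extension[OF weave_compact weave_up k] by blast
    have le: "lower_val k s \<le> lower_val g s" "upper_val g s \<le> upper_val k s" for s
      using g ku max_pathsD(2) by (auto simp: extended_by_iff)
    show ?thesis
    proof (cases "g \<in> X")
      case True
      then have "lower_val k s \<le> upper_val h s" for s
        using le(1)[of s] lower_val_le_cut_boundary[OF True, of s] hh by auto
      then show ?thesis using ku hu by (simp add: crosses_iff below_iff)
    next
      case False
      then have "lower_val h s \<le> upper_val k s" for s
        using le(2)[of s] cut_boundary_le_outside[OF X g(1) False, of s] hl by auto
      then show ?thesis using ku hu by (simp add: crosses_iff below_iff)
    qed
  qed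
  then show "h \<in> flow A" using h(1) by (auto simp: flow_def crosses_set_def)
  show "cut_of A h = X"
    unfolding cut_of_eq[OF hu]
  proof (intro equalityI subsetI)
    fix f assume f: "f \<in> {g \<in> max_paths A. below g h \<and> \<not> below h g}"
    show "f \<in> X"
    proof (rule ccontr)
      assume "f \<notin> X"
      then have "lower_val h s \<le> upper_val f s" for s
        using cut_boundary_le_outside[OF X] f hl by simp
      then show False using f hu max_pathsD(2) by (auto simp: below_iff)
    qed
  next
    fix f assume f: "f \<in> X"
    then have fM: "f \<in> max_paths A" using dedekind_cutD(1)[OF X] by blast
    then have fu: "f \<in> paths_up" using max_pathsD by blast
    have "below f h"
      using lower_val_le_cut_boundary[OF f] fu hu hh by (simp add: below_iff)
    \<comment> \<open>The absence of a maximal element enters here: some \<open>g\<close> in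
      \<open>X\<close> exceeds \<open>f\<close> strictly at a split time, and then so does the
      boundary.\<close>
    moreover obtain g where g: "g \<in> X" "below f g" "g \<noteq> f" using dedekind_cutD(4)[OF X f] by blast
    have gM: "g \<in> max_paths A" using dedekind_cutD(1)[OF X] g(1) by blast
    then have "\<not> below g f" using max_paths_below_antisym[OF fM gM] g by blast
    then obtain s where "upper_val f s < lower_val g s"
      using fu gM max_pathsD(2) by (auto simp: below_iff not_le)
    then have "upper_val f s < lower_val h s"
      using lower_val_le_cut_boundary[OF g(1), of s] hl by auto
    then have "\<not> below h f" using fu hu by (auto simp: below_iff not_le)
    ultimately show "f \<in> {g \<in> max_paths A. below g h \<and> \<not> below h g}" using fM by blast
  qed
qed

text \<open>By \<open>extended_by_iff\<close> the two-sided estimate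
  \<open>cut_boundary_cut_of\<close> is exactly an extension. It yields the second claim and, for
  bi-infinite f, that f is recovered from its cut.\<close>

lemma extended_by_cut_path:
  assumes f: "f \<in> paths_up" "\<not> crosses_set f A"
  shows "extended_by f (biinfinite_path (cut_boundary (cut_of A f)))"
  using cut_path(1-3)[OF cut_of_dedekind[OF f]] cut_boundary_cut_of[OF f] f(1)
  by (simp add: extended_by_iff)

lemma flowD: "h \<in> flow A \<Longrightarrow> h \<in> paths_updown" "h \<in> flow A \<Longrightarrow> h \<in> paths_up" "h \<in> flow A \<Longrightarrow> \<not> crosses_set h A"
  by (auto simp: flow_def paths_updown_def)

lemma cut_path_cut_of:
  assumes h: "h \<in> flow A"
  shows "biinfinite_path (cut_boundary (cut_of A h)) = h"
proof -
  note h' = flowD[OF h]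
  have e: "extended_by h (biinfinite_path (cut_boundary (cut_of A h)))"
    by (rule extended_by_cut_path[OF h'(2,3)])
  note p = cut_path(1-3)[OF cut_of_dedekind[OF h'(2,3)]]
  \<comment> \<open>The two bounds of a bi-infinite path coincide, so the sandwich determines the
    boundary.\<close>
  have "cut_boundary (cut_of A h) s = path_val h s" for s
    using cut_boundary_cut_of[OF h'(2,3), of s] updown_vals[OF h'(1)] by (auto intro: antisym)
  then have "extended_by (biinfinite_path (cut_boundary (cut_of A h))) h"
    using p h'(2) updown_vals[OF h'(1)] by (simp add: extended_by_iff)
  then show ?thesis using e p(1) h'(2) extended_by_antisym by blast
qed

end

theorem theorem4p3p9:
  fixes A :: "path set"
  assumes "deterministic_weave A"
  shows "bij_betw (cut_of A) (flow A) (dedekind_cuts A) \<and>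
    (\<forall>X\<in>dedekind_cuts A.
       cadlag (-\<infinity>) \<infinity> (cut_boundary X) \<and>
       biinfinite_path (cut_boundary X) \<in> flow A \<and>
       cut_of A (biinfinite_path (cut_boundary X)) = X) \<and>
    (\<forall>h\<in>flow A. biinfinite_path (cut_boundary (cut_of A h)) = h) \<and>
    (\<forall>f\<in>paths_up. \<not> crosses_set f A \<longrightarrow> (\<exists>h\<in>flow A. extended_by f h))"
proof (intro conjI ballI impI)
  show "bij_betw (cut_of A) (flow A) (dedekind_cuts A)"
    using cut_path(4,5)[OF assms] cut_path_cut_of[OF assms] cut_of_dedekind[OF assms flowD(2,3)[OF assms]]
    by (intro bij_betw_byWitness[where f' = "\<lambda>X. biinfinite_path (cut_boundary X)"]) auto
next
  fix f assume "f \<in> paths_up" "\<not> crosses_set f A"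
  then show "\<exists>h\<in>flow A. extended_by f h"
    using extended_by_cut_path[OF assms] cut_path(4)[OF assms cut_of_dedekind[OF assms]] by blast
qed (use cadlag_cut_boundary[OF assms] cut_path(4,5)[OF assms] cut_path_cut_of[OF assms] in auto)

end
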